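(* Let $(X,d)$ be a totally bounded metric space and let $0<\theta<1$. If $\overline{\dim}_\theta X < 1$, then $C\overline{\dim}_\theta X = 0$.
   Context: A metric space $Z$ is uniformly perfect if there is $0<c<1$ such that $B(z,r)\setminus B(z,cr)\neq\emptyset$ for every closed ball $B(z,r)$ with $r<\operatorname{diam}(Z)$. Upper $\theta$-intermediate dimension: let $X$ be a totally bounded metric space and $0<\theta<1$. Fix an isometric embedding of $X$ into a uniformly perfect metric space $Z$ having at least two points (for instance $Z=\ell^\infty$; the resulting value does not depend on the choice). Then $\overline{\dim}_\theta X$ is the infimum of those $s>0$ such that for each $\epsilon>0$ there exists $\delta_0>0$ so that for each $0<\delta\le\delta_0$ there is a countable covering $(A_i)$ of $X$ by subsets of $Z$ satisfying $\delta^{1/\theta}\le \operatorname{diam}(A_i)\le\delta$ for all $i$ and $\sum_i (\operatorname{diam} A_i)^s<\epsilon$. Metric spaces $(X,d)$ and $(Y,d')$ are quasisymmetrically equivalent if there exist a homeomorphism $f:X\to Y$ and an increasing homeomorphism $\eta:[0,\infty)\to[0,\infty)$ with $$\frac{d'(f(x),f(a))}{d'(f(x),f(b))}\le \eta\left(\frac{d(x,a)}{d(x,b)}\right)\quad\text{for all } x,a,b\in X,\ x\ne b.$$ Conformal $\theta$-intermediate dimension: $C\overline{\dim}_\theta X := \inf\{\overline{\dim}_\theta Y : Y \text{ is a metric space quasisymmetrically equivalent to } X\}$. *)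

theory Defs
  imports "HOL-Analysis.Analysis"
begin

text \<open>The diameter takes values in \<^typ>\<open>ennreal\<close>, so that unbounded sets have diameter
  \<open>\<infinity>\<close> and the empty set has diameter \<open>0\<close>.\<close>

definition ediam :: "('a \<Rightarrow> 'a \<Rightarrow> real) \<Rightarrow> 'a set \<Rightarrow> ennreal" where
  "ediam d A = (SUP (x, y) \<in> A \<times> A. ennreal (d x y))"

definition uniformly_perfect :: "'a set \<Rightarrow> ('a \<Rightarrow> 'a \<Rightarrow> real) \<Rightarrow> bool" where
  "uniformly_perfect Z d \<longleftrightarrow> Metric_space Z d \<and>
     (\<exists>c. 0 < c \<and> c < 1 \<and>
       (\<forall>z\<in>Z. \<forall>r>0. ennreal r < ediam d Z \<longrightarrow>
          Metric_space.mcball Z d z r - Metric_space.mcball Z d z (c * r) \<noteq> {}))"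

definition isometric_embedding ::
  "'a set \<Rightarrow> ('a \<Rightarrow> 'a \<Rightarrow> real) \<Rightarrow> 'b set \<Rightarrow> ('b \<Rightarrow> 'b \<Rightarrow> real) \<Rightarrow> ('a \<Rightarrow> 'b) \<Rightarrow> bool" where
  "isometric_embedding X d Z d' f \<longleftrightarrow>
     f \<in> X \<rightarrow> Z \<and> (\<forall>x\<in>X. \<forall>y\<in>X. d' (f x) (f y) = d x y)"

text \<open>The upper \<open>\<theta>\<close>-intermediate dimension of a subset \<open>E\<close> of an ambient metric space \<open>Z\<close>.
  Countable coverings are indexed by a (possibly finite) set \<open>I\<close> of natural numbers. The sum is
  taken in \<^typ>\<open>ennreal\<close>, where it always exists; the diameters in it are finite, since they are
  at most \<open>\<delta>\<close>. The infimum over the empty set is \<open>\<infinity>\<close>.\<close>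

definition upper_intermediate_dim_in ::
  "'a set \<Rightarrow> ('a \<Rightarrow> 'a \<Rightarrow> real) \<Rightarrow> 'a set \<Rightarrow> real \<Rightarrow> ereal" where
  "upper_intermediate_dim_in Z d E \<theta> = Inf (ereal ` {s. s > 0 \<and>
     (\<forall>\<epsilon>>0. \<exists>\<delta>\<^sub>0>0. \<forall>\<delta>. 0 < \<delta> \<and> \<delta> \<le> \<delta>\<^sub>0 \<longrightarrow>
       (\<exists>(I :: nat set) A.
          (\<forall>i\<in>I. A i \<subseteq> Z \<and>
             ennreal (\<delta> powr (1 / \<theta>)) \<le> ediam d (A i) \<and> ediam d (A i) \<le> ennreal \<delta>) \<and>
          E \<subseteq> (\<Union>i\<in>I. A i) \<and>
          (\<Sum>\<^sub>\<infinity>i\<in>I. ennreal (enn2real (ediam d (A i)) powr s)) < ennreal \<epsilon>))})"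

text \<open>An ambient space as in the definition of the intermediate dimension of \<open>(X, d)\<close>: a uniformly
  perfect metric space with at least two points, together with an isometric embedding of \<open>X\<close>.
  The type \<^typ>\<open>nat \<Rightarrow>\<^sub>C real\<close> is the space of bounded real sequences; its subsets \<open>Z\<close> with arbitrary
  metrics \<open>dZ\<close> represent, up to isometry, all metric spaces of at most continuum cardinality.\<close>

definition ambient_space ::
  "'a set \<Rightarrow> ('a \<Rightarrow> 'a \<Rightarrow> real) \<Rightarrow>
   (nat \<Rightarrow>\<^sub>C real) set \<times> ((nat \<Rightarrow>\<^sub>C real) \<Rightarrow> (nat \<Rightarrow>\<^sub>C real) \<Rightarrow> real) \<times> ('a \<Rightarrow> (nat \<Rightarrow>\<^sub>C real)) \<Rightarrow> bool"
where
  "ambient_space X d = (\<lambda>(Z, dZ, f).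
     uniformly_perfect Z dZ \<and> (\<exists>x\<in>Z. \<exists>y\<in>Z. x \<noteq> y) \<and> isometric_embedding X d Z dZ f)"

definition upper_intermediate_dim :: "'a set \<Rightarrow> ('a \<Rightarrow> 'a \<Rightarrow> real) \<Rightarrow> real \<Rightarrow> ereal" where
  "upper_intermediate_dim X d \<theta> =
     (let (Z, dZ, f) = (SOME p. ambient_space X d p)
      in upper_intermediate_dim_in Z dZ (f ` X) \<theta>)"

definition quasisymmetrically_equivalent ::
  "'a set \<Rightarrow> ('a \<Rightarrow> 'a \<Rightarrow> real) \<Rightarrow> 'b set \<Rightarrow> ('b \<Rightarrow> 'b \<Rightarrow> real) \<Rightarrow> bool" where
  "quasisymmetrically_equivalent X d Y d' \<longleftrightarrow>
     (\<exists>f \<eta>. homeomorphic_map (Metric_space.mtopology X d) (Metric_space.mtopology Y d') f \<and>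
        homeomorphic_map (top_of_set {0::real..}) (top_of_set {0::real..}) \<eta> \<and>
        strict_mono_on {0..} \<eta> \<and>
        (\<forall>x\<in>X. \<forall>a\<in>X. \<forall>b\<in>X. x \<noteq> b \<longrightarrow>
           d' (f x) (f a) / d' (f x) (f b) \<le> \<eta> (d x a / d x b)))"

text \<open>The metric spaces \<open>Y\<close> have their points in the type of the points of \<open>X\<close>. Up to isometry this
  is no restriction, as \<open>Y\<close> is in bijection with \<open>X\<close>.\<close>

definition conformal_upper_intermediate_dim ::
  "'a set \<Rightarrow> ('a \<Rightarrow> 'a \<Rightarrow> real) \<Rightarrow> real \<Rightarrow> ereal" where
  "conformal_upper_intermediate_dim X d \<theta> =
     Inf {upper_intermediate_dim Y d' \<theta> | (Y :: 'a set) d'.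
            Metric_space Y d' \<and> quasisymmetrically_equivalent X d Y d'}"

text \<open>Every totally bounded metric space has an ambient space: it embeds isometrically
  into \<open>\<ell>\<^sup>\<infinity>\<close>.\<close>

lemma uniformly_perfect_linfty: "uniformly_perfect (UNIV :: (nat \<Rightarrow>\<^sub>C real) set) dist"
proof -
  have "Met_TC.mcball z r - Met_TC.mcball z (1/2 * r) \<noteq> {}" if "r > 0" for z :: "nat \<Rightarrow>\<^sub>C real" and r :: real
  proof -
    have n: "norm (const_bcontfun 1 :: nat \<Rightarrow>\<^sub>C real) = 1"
    proof (rule antisym)
      show "norm (const_bcontfun 1 :: nat \<Rightarrow>\<^sub>C real) \<le> 1"
        by (rule norm_bound) simp
      show "1 \<le> norm (const_bcontfun 1 :: nat \<Rightarrow>\<^sub>C real)"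
        using norm_bounded[of "const_bcontfun 1 :: nat \<Rightarrow>\<^sub>C real" 0] by simp
    qed
    have "dist z (z + r *\<^sub>R const_bcontfun 1) = r"
      using n that by (simp add: dist_norm norm_minus_commute)
    then have "z + r *\<^sub>R const_bcontfun 1 \<in> Met_TC.mcball z r - Met_TC.mcball z (1/2 * r)"
      using that by auto
    then show ?thesis by blast
  qed
  then show ?thesis
    unfolding uniformly_perfect_def using Met_TC.Metric_space_axioms
    by (intro conjI exI[of _ "1/2 :: real"]) auto
qed

lemma isometric_embedding_linfty:
  assumes "Metric_space X d" and tb: "Metric_space.mtotally_bounded X d X"
  shows "\<exists>f :: 'a \<Rightarrow> (nat \<Rightarrow>\<^sub>C real). isometric_embedding X d UNIV dist f"
proof (cases "X = {}")
  case True
  then show ?thesis by (auto simp: isometric_embedding_def)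
next
  case False
  interpret Metric_space X d by fact
  have "\<forall>n::nat. \<exists>K. finite K \<and> K \<subseteq> X \<and> X \<subseteq> (\<Union>x\<in>K. mball x (1 / Suc n))"
    using tb unfolding mtotally_bounded_def by simp
  then obtain K where K: "\<And>n. finite (K n)" "\<And>n. K n \<subseteq> X"
      "\<And>n. X \<subseteq> (\<Union>x\<in>K n. mball x (1 / Suc n))"
    by metis
  define D where "D = (\<Union>n. K n)"
  have "countable D"
    unfolding D_def using K(1) by (auto intro: countable_finite)
  moreover have "D \<noteq> {}"
    using K(3)[of 0] False unfolding D_def by fastforce
  ultimately obtain q :: "nat \<Rightarrow> 'a" where q: "range q = D"
    by (metis uncountable_def)
  have qX: "q n \<in> X" for n
    using q K(2) unfolding D_def by blast
  obtain c B where cB: "X \<subseteq> mcball c B"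
    using mtotally_bounded_imp_mbounded[OF tb] unfolding mbounded_def by blast
  have bd: "(\<lambda>n. d x (q n)) \<in> bcontfun" if "x \<in> X" for x
  proof (rule bcontfun_normI)
    show "continuous_on UNIV (\<lambda>n. d x (q n))"
      by (simp add: continuous_on_discrete)
    fix n
    have "c \<in> X" "d c x \<le> B" "d c (q n) \<le> B"
      using cB that qX[of n] by auto
    then show "norm (d x (q n)) \<le> 2 * B"
      using triangle[of x c "q n"] commute[of c x] that qX[of n] by simp
  qed
  define f where "f x = Bcontfun (\<lambda>n. d x (q n))" for x
  have f: "apply_bcontfun (f x) n = d x (q n)" if "x \<in> X" for x n
    unfolding f_def using Bcontfun_inverse[OF bd[OF that]] by simp
  have "dist (f x) (f y) = d x y" if xy: "x \<in> X" "y \<in> X" for x y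
  proof (rule antisym)
    show "dist (f x) (f y) \<le> d x y"
    proof (rule dist_bound)
      fix n
      show "dist (f x n) (f y n) \<le> d x y"
        using triangle[of x y "q n"] triangle[of y x "q n"] commute[of x y] xy qX[of n]
        by (auto simp: f dist_real_def)
    qed
    show "d x y \<le> dist (f x) (f y)"
    proof (rule field_le_epsilon)
      fix e :: real assume "e > 0"
      then obtain m where m: "1 / Suc m < e / 2"
        using nat_approx_posE[of "e/2"] by auto
      obtain p where p: "p \<in> K m" "d p x < 1 / Suc m"
        using K(3)[of m] xy by force
      then obtain n where n: "q n = p"
        using q unfolding D_def by (metis UN_I UNIV_I imageE)
      have "dist (f x n) (f y n) \<le> dist (f x) (f y)"
        by (rule dist_bounded)
      then show "d x y \<le> dist (f x) (f y) + e"
        using triangle[of x p y] commute[of x p] commute[of y p] xy qX[of n] n p m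
        by (auto simp: f dist_real_def)
    qed
  qed
  then show ?thesis
    unfolding isometric_embedding_def by blast
qed

lemma ambient_space_exists:
  assumes "Metric_space X d" "Metric_space.mtotally_bounded X d X"
  shows "\<exists>p. ambient_space X d p"
proof -
  obtain f :: "'a \<Rightarrow> (nat \<Rightarrow>\<^sub>C real)" where "isometric_embedding X d UNIV dist f"
    using isometric_embedding_linfty[OF assms] by blast
  moreover have "const_bcontfun 0 \<noteq> (const_bcontfun 1 :: nat \<Rightarrow>\<^sub>C real)"
    by (metis const_bcontfun.rep_eq zero_neq_one)
  ultimately have "ambient_space X d (UNIV, dist, f)"
    unfolding ambient_space_def using uniformly_perfect_linfty by auto
  then show ?thesis ..
qed

end

theory Submission
  imports Defs
begin

text \<open>Fix exponents \<open>s < \<sigma> < \<gamma> < 1\<close> with \<open>s\<close> admissible in the definition of the dimension, and take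
  admissible coverings of \<open>X\<close> at the scales \<open>2\<^sup>-\<^sup>n\<close>. The sets of all these coverings have points
  \<open>p\<^sub>j\<close> and diameters \<open>r\<^sub>j\<close> with \<open>\<Sum>\<^sub>j r\<^sub>j\<^sup>\<sigma> < \<infinity>\<close>; put \<open>m\<^sub>j = r\<^sub>j\<^sup>\<sigma>\<close>. Shrink the metric by the
  \<open>K\<close>-th power of the Riesz potential \<open>u(x, r) = 1 + \<Sum>\<^sub>j m\<^sub>j max(r, d(x, p\<^sub>j))\<^sup>-\<^sup>\<gamma>\<close>, which is at least
  \<open>c r\<^sub>j\<^sup>\<sigma>\<^sup>-\<^sup>\<gamma>\<close> at the scale of the \<open>j\<close>-th set: if a metric \<open>d'\<close> is comparable to
  \<open>d(x, y) / u(x, d(x, y))\<^sup>K\<close>, then \<open>d'\<close> is quasisymmetric to \<open>d\<close>, and the \<open>j\<close>-th set has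
  \<open>d'\<close>-diameter at most a constant times the power of \<open>r\<^sub>j\<close> with exponent \<open>1 + K(\<gamma> - \<sigma>)\<close>, which is
  arbitrarily large. Since the windows \<open>[\<delta>\<^sup>1\<^sup>/\<^sup>\<theta>, \<delta>]\<close> are compatible with powers, the same coverings
  show that the dimension of \<open>(X, d')\<close> is arbitrarily small.

  Such a metric is \<open>d'(x, y) = sup\<^sub>z \<integral> U\<^sub>z(t)\<^sup>-\<^sup>K dt\<close>, with \<open>t\<close> between \<open>d(z, x)\<close> and \<open>d(z, y)\<close> and
  \<open>U\<^sub>z(t) = 1 + \<Sum>\<^sub>j m\<^sub>j |t - d(z, p\<^sub>j)|\<^sup>-\<^sup>\<gamma>\<close>. The upper estimate holds because \<open>U\<^sub>z(t) \<ge> u(x, r) / 2\<close>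
  whenever \<open>|t - d(z, x)| \<le> r\<close>. For the lower one take \<open>z = x\<close>: as \<open>\<gamma> < 1\<close>, the mean of \<open>U\<^sub>x\<close> over
  \<open>[0, r]\<close> is at most a constant times \<open>u(x, r)\<close>.\<close>

section \<open>One-dimensional Riesz kernels\<close>

lemma ennreal_inverse_antimono:
  fixes a b :: ennreal
  assumes "a \<le> b"
  shows "inverse b \<le> inverse a"
proof (cases "a = 0 \<or> b = top")
  case False
  then obtain x y where "a = ennreal x" "b = ennreal y" "0 < x" "x \<le> y"
    using assms by (cases a; cases b) (auto simp: top_unique)
  then show ?thesis by (simp add: inverse_ennreal ennreal_leI le_imp_inverse_le)
qed auto

lemma nn_integral_inverse_abs_powr:
  fixes \<gamma> c :: real
  assumes "\<gamma> < 1" and "0 \<le> c"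
  shows "(\<integral>\<^sup>+t\<in>{-c..c}. inverse (ennreal (\<bar>t\<bar> powr \<gamma>)) \<partial>lborel)
    \<le> ennreal (2 * c powr (1 - \<gamma>) / (1 - \<gamma>))"
proof -
  define g where "g t = inverse (ennreal (\<bar>t\<bar> powr \<gamma>))" for t
  have [measurable]: "g \<in> borel_measurable borel"
    unfolding g_def by measurable
  have half: "(\<integral>\<^sup>+t\<in>{0..c}. g t \<partial>lborel) = ennreal (c powr (1 - \<gamma>) / (1 - \<gamma>))"
  proof -
    have "(\<integral>\<^sup>+t\<in>{0..c}. g t \<partial>lborel) = (\<integral>\<^sup>+t. ennreal (t powr (-\<gamma>)) * indicator {0..c} t \<partial>lborel)"
    \<comment> \<open>The two integrands differ at 0:
      \<open>inverse (ennreal (0 powr \<gamma>))\<close> is infinite, while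
      \<open>0 powr - \<gamma>\<close> is 0. Hence only almost everywhere equality.\<close>
    proof (intro nn_integral_cong_AE AE_I[of _ _ "{0}"])
      show "{x \<in> space lborel. g x * indicator {0..c} x \<noteq> ennreal (x powr - \<gamma>) * indicator {0..c} x} \<subseteq> {0}"
      proof
        fix x assume x: "x \<in> {x \<in> space lborel. g x * indicator {0..c} x \<noteq> ennreal (x powr - \<gamma>) * indicator {0..c} x}"
        show "x \<in> {0}"
        proof (rule ccontr)
          assume "x \<notin> {0}"
          then have "0 < x powr \<gamma>" by simp
          with x show False
            by (cases "x \<in> {0..c}") (auto simp: g_def inverse_ennreal powr_minus)
        qed
      qed
    qed auto
    also have "\<dots> = ennreal (c powr (-\<gamma> + 1) / (-\<gamma> + 1))"
      using assms by (intro nn_integral_has_integral_lebesgue' has_integral_powr_from_0) auto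
    finally show ?thesis by (simp add: add.commute)
  qed
  have "(\<integral>\<^sup>+t\<in>{-c..0}. g t \<partial>lborel) = (\<integral>\<^sup>+t\<in>{0..c}. g t \<partial>lborel)"
    by (subst nn_integral_real_affine[of _ "-1" 0])
       (auto simp: g_def indicator_def intro!: nn_integral_cong)
  moreover have "(\<integral>\<^sup>+t\<in>{-c..c}. g t \<partial>lborel)
      \<le> (\<integral>\<^sup>+t. g t * indicator {-c..0} t + g t * indicator {0..c} t \<partial>lborel)"
    by (intro nn_integral_mono) (auto simp: indicator_def)
  moreover have "\<dots> = (\<integral>\<^sup>+t\<in>{-c..0}. g t \<partial>lborel) + (\<integral>\<^sup>+t\<in>{0..c}. g t \<partial>lborel)"
    by (intro nn_integral_add) auto
  ultimately show ?thesis
    using half assms by (simp add: g_def ennreal_plus[symmetric] del: ennreal_plus)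
qed

text \<open>Two regimes. If \<open>2 * R \<le> a\<close>, the pole is far away:
  \<open>\<bar>t - a\<bar> \<ge> a / 2\<close> on the whole interval, so the kernel is at most
  \<open>2 * a powr (-\<gamma>)\<close>. Otherwise the interval translated by \<open>-a\<close> lies
  in \<open>{-(2*R)..2*R}\<close>, where the integrable singularity is computed exactly, and
  \<open>max R a \<le> 2 * R\<close>.\<close>

lemma nn_integral_inverse_dist_powr:
  fixes \<gamma> a R :: real
  assumes \<gamma>: "0 < \<gamma>" "\<gamma> < 1" and "0 \<le> a" "0 < R"
  shows "(\<integral>\<^sup>+t\<in>{0..R}. inverse (ennreal (\<bar>t - a\<bar> powr \<gamma>)) \<partial>lborel)
    \<le> ennreal (4 / (1 - \<gamma>) * R * max R a powr (-\<gamma>))"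
proof (cases "2 * R \<le> a")
  case True
  have half: "(a / 2) powr (-\<gamma>) \<le> 2 * a powr (-\<gamma>)"
    using \<gamma> True \<open>0 < R\<close> powr_mono[of \<gamma> 1 2] by (simp add: powr_divide powr_minus field_simps)
  have "(\<integral>\<^sup>+t\<in>{0..R}. inverse (ennreal (\<bar>t - a\<bar> powr \<gamma>)) \<partial>lborel)
      \<le> (\<integral>\<^sup>+t\<in>{0..R}. ennreal (2 * a powr (-\<gamma>)) \<partial>lborel)"
  proof (intro nn_integral_mono)
    fix t
    have "inverse (ennreal (\<bar>t - a\<bar> powr \<gamma>)) \<le> ennreal (2 * a powr (-\<gamma>))" if "t \<in> {0..R}"
    proof -
      have "(a / 2) powr \<gamma> \<le> \<bar>t - a\<bar> powr \<gamma>" "0 < \<bar>t - a\<bar> powr \<gamma>"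
        using that True \<gamma> \<open>0 < R\<close> by (auto intro!: powr_mono2)
      moreover have "0 < (a / 2) powr \<gamma>"
        using True \<open>0 < R\<close> by simp
      ultimately have "inverse (\<bar>t - a\<bar> powr \<gamma>) \<le> (a / 2) powr (-\<gamma>)"
        unfolding powr_minus by (intro le_imp_inverse_le)
      then show ?thesis
        using half \<open>0 < \<bar>t - a\<bar> powr \<gamma>\<close> by (simp add: inverse_ennreal ennreal_leI)
    qed
    then show "inverse (ennreal (\<bar>t - a\<bar> powr \<gamma>)) * indicator {0..R} t
        \<le> ennreal (2 * a powr (-\<gamma>)) * indicator {0..R} t"
      by (auto simp: indicator_def)
  qed
  also have "\<dots> = ennreal (2 * R * a powr (-\<gamma>))"
    using \<open>0 < R\<close> by (subst nn_integral_cmult_indicator) (simp_all add: ennreal_mult[symmetric] mult_ac)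
  also have "\<dots> \<le> ennreal (4 / (1 - \<gamma>) * R * max R a powr (-\<gamma>))"
    using True \<gamma> \<open>0 < R\<close> by (intro ennreal_leI) (auto simp: max_def field_simps intro!: mult_right_mono)
  finally show ?thesis .
next
  case False
  define g where "g t = inverse (ennreal (\<bar>t\<bar> powr \<gamma>))" for t
  have [measurable]: "g \<in> borel_measurable borel"
    unfolding g_def by measurable
  have "(\<integral>\<^sup>+t\<in>{0..R}. g (t - a) \<partial>lborel) = (\<integral>\<^sup>+t. g t * indicator {0..R} (a + t) \<partial>lborel)"
    by (subst nn_integral_real_affine[of _ 1 a]) simp_all
  also have "\<dots> \<le> (\<integral>\<^sup>+t\<in>{-(2*R)..2*R}. g t \<partial>lborel)"
    using False assms by (intro nn_integral_mono) (auto simp: indicator_def)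
  also have "\<dots> \<le> ennreal (2 * (2*R) powr (1 - \<gamma>) / (1 - \<gamma>))"
    unfolding g_def using assms by (intro nn_integral_inverse_abs_powr) auto
  also have "\<dots> = ennreal (4 / (1 - \<gamma>) * R * (2*R) powr (-\<gamma>))"
    using \<open>0 < R\<close> powr_add[of "2*R" 1 "-\<gamma>"] by (simp add: field_simps)
  also have "\<dots> \<le> ennreal (4 / (1 - \<gamma>) * R * max R a powr (-\<gamma>))"
    using False assms by (intro ennreal_leI mult_left_mono powr_mono2') auto
  finally show ?thesis by (simp add: g_def)
qed

section \<open>The deformed metric\<close>

locale metric_potential = Metric_space M d for M :: "'a set" and d +
  fixes p :: "nat \<Rightarrow> 'a" and m :: "nat \<Rightarrow> real" and \<gamma> :: real and K :: nat
  assumes p_in: "p j \<in> M" and m_nonneg: "0 \<le> m j" and m_summable: "summable m"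
    and \<gamma>_pos: "0 < \<gamma>" and \<gamma>_less_1: "\<gamma> < 1"
begin

definition potential :: "'a \<Rightarrow> real \<Rightarrow> real" where
  "potential x r = 1 + (\<Sum>j. m j * max r (d x (p j)) powr (-\<gamma>))"

text \<open>The Riesz potential on the real line of the masses transported by \<open>d z\<close>. It
  is not truncated: at \<open>t = d z (p j)\<close> with \<open>0 < m j\<close> its value is
  infinite, which \<open>ennreal\<close> admits, so that monotone estimates and termwise integration
  need no exceptional set.\<close>

definition line_potential :: "'a \<Rightarrow> real \<Rightarrow> ennreal" where
  "line_potential z t = 1 + (\<Sum>j. ennreal (m j) * inverse (ennreal (\<bar>t - d z (p j)\<bar> powr \<gamma>)))"

definition slice :: "'a \<Rightarrow> 'a \<Rightarrow> 'a \<Rightarrow> ennreal" where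
  "slice z x y =
     (\<integral>\<^sup>+t\<in>{min (d z x) (d z y)..max (d z x) (d z y)}. inverse (line_potential z t ^ K) \<partial>lborel)"

text \<open>As a supremum of lengths of intervals this is a pseudometric without any recourse to chains.\<close>

definition deformed :: "'a \<Rightarrow> 'a \<Rightarrow> real" where
  "deformed x y = enn2real (SUP z\<in>M. slice z x y)"

section \<open>Estimates for the potential and its one-dimensional counterpart\<close>

lemma line_potential_measurable [measurable]: "line_potential z \<in> borel_measurable borel"
  unfolding line_potential_def by measurable

lemma line_potential_ge_1: "1 \<le> line_potential z t"
  unfolding line_potential_def by simp

lemma potential_summable:
  assumes "0 < r"
  shows "summable (\<lambda>j. m j * max r (d x (p j)) powr (-\<gamma>))"
proof (rule summable_comparison_test')
  show "summable (\<lambda>j. m j * r powr (-\<gamma>))"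
    using m_summable by (rule summable_mult2)
  show "norm (m j * max r (d x (p j)) powr (-\<gamma>)) \<le> m j * r powr (-\<gamma>)" for j
    using assms m_nonneg \<gamma>_pos by (auto intro!: mult_left_mono powr_mono2')
qed

lemma potential_ge_term:
  assumes "0 < r"
  shows "m j * max r (d x (p j)) powr (-\<gamma>) \<le> potential x r"
  using sum_le_suminf[OF potential_summable[OF assms], of "{j}" x] m_nonneg
  by (simp add: potential_def)

lemma potential_ge_1: "0 < r \<Longrightarrow> 1 \<le> potential x r"
  unfolding potential_def using potential_summable m_nonneg by (simp add: suminf_nonneg)

lemma potential_antimono:
  assumes "0 < r" "r \<le> R"
  shows "potential x R \<le> potential x r"
  unfolding potential_def using assms m_nonneg \<gamma>_pos
  by (auto intro!: suminf_le potential_summable mult_left_mono powr_mono2')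

text \<open>Together with \<open>potential_antimono\<close> this limits how much the potential
  varies between two scales at the same point, which is what quasisymmetry requires. Termwise,
  \<open>max R D \<le> R / r * max r D\<close>, and \<open>(R / r) powr \<gamma> \<le> R / r\<close>
  because \<open>R / r \<ge> 1\<close> and \<open>\<gamma> < 1\<close>.\<close>

lemma potential_le_scaled:
  assumes "0 < r" "r \<le> R"
  shows "potential x r \<le> R / r * potential x R"
proof -
  have R: "1 \<le> R / r" using assms by simp
  have "max r D powr (-\<gamma>) \<le> R / r * max R D powr (-\<gamma>)" for D
  proof -
    have "max R D \<le> R / r * max r D"
    proof (rule max.boundedI)
      show "R \<le> R / r * max r D"
        using assms R mult_left_mono[of r "max r D" "R / r"] by simp
      show "D \<le> R / r * max r D"
        using assms R mult_mono[of 1 "R / r" "max r D" "max r D"] by simp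
    qed
    then have "max R D powr \<gamma> \<le> (R / r * max r D) powr \<gamma>"
      using assms \<gamma>_pos by (intro powr_mono2) auto
    also have "\<dots> = (R / r) powr \<gamma> * max r D powr \<gamma>"
      by (rule powr_mult)
    also have "(R / r) powr \<gamma> \<le> R / r"
      using powr_mono[of \<gamma> 1 "R / r"] R \<gamma>_less_1 by simp
    finally have "max R D powr \<gamma> \<le> R / r * max r D powr \<gamma>"
      by (simp add: mult_right_mono)
    then show ?thesis
      using assms by (simp add: powr_minus field_simps)
  qed
  then have "m j * max r (d x (p j)) powr (-\<gamma>) \<le> R / r * (m j * max R (d x (p j)) powr (-\<gamma>))" for j
    using m_nonneg[of j] by (metis mult.left_commute mult_left_mono)
  then have "(\<Sum>j. m j * max r (d x (p j)) powr (-\<gamma>))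
      \<le> (\<Sum>j. R / r * (m j * max R (d x (p j)) powr (-\<gamma>)))"
    using assms by (intro suminf_le potential_summable summable_mult) auto
  also have "\<dots> = R / r * (\<Sum>j. m j * max R (d x (p j)) powr (-\<gamma>))"
    using assms by (intro suminf_mult potential_summable) auto
  finally show ?thesis
    using R unfolding potential_def by (simp add: distrib_left)
qed

text \<open>Since \<open>d z\<close> is 1-Lipschitz,
  \<open>\<bar>t - d z (p j)\<bar> \<le> R + d x (p j)\<close>, which is at most twice
  \<open>max R (d x (p j))\<close>. The kernel thus loses at most the factor
  \<open>2 powr \<gamma> \<le> 2\<close>, uniformly in \<open>z\<close>; this uniformity later
  permits the supremum over \<open>z\<close>.\<close>

lemma line_potential_ge:
  assumes "z \<in> M" "x \<in> M" "0 < R" "\<bar>t - d z x\<bar> \<le> R"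
  shows "ennreal (potential x R / 2) \<le> line_potential z t"
proof -
  have "ennreal (m j * max R (d x (p j)) powr (-\<gamma>) / 2)
      \<le> ennreal (m j) * inverse (ennreal (\<bar>t - d z (p j)\<bar> powr \<gamma>))" for j
  proof -
    define D where "D = max R (d x (p j))"
    have "\<bar>t - d z (p j)\<bar> \<le> 2 * D"
      using assms triangle[of z x "p j"] triangle[of z "p j" x] commute[of x "p j"] p_in[of j]
      unfolding D_def by (auto simp: max_def)
    then have "\<bar>t - d z (p j)\<bar> powr \<gamma> \<le> 2 powr \<gamma> * D powr \<gamma>"
      using \<gamma>_pos assms powr_mono2[of \<gamma> "\<bar>t - d z (p j)\<bar>" "2 * D"] unfolding D_def
      by (simp add: powr_mult)
    also have "\<dots> \<le> 2 * D powr \<gamma>"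
      using \<gamma>_less_1 powr_mono[of \<gamma> 1 2] by (simp add: mult_right_mono)
    finally have "inverse (ennreal (2 * D powr \<gamma>)) \<le> inverse (ennreal (\<bar>t - d z (p j)\<bar> powr \<gamma>))"
      by (intro ennreal_inverse_antimono ennreal_leI)
    moreover have "inverse (ennreal (2 * D powr \<gamma>)) = ennreal (D powr (-\<gamma>) / 2)"
      using assms unfolding D_def
      by (subst inverse_ennreal) (auto simp: powr_minus field_simps)
    ultimately show ?thesis
      using mult_left_mono[of "ennreal (D powr (-\<gamma>) / 2)" _ "ennreal (m j)"] m_nonneg[of j]
      by (auto simp: D_def ennreal_mult[symmetric] simp del: times_divide_eq_right)
        (simp add: ennreal_mult[symmetric])
  qed
  then have "(\<Sum>j. ennreal (m j * max R (d x (p j)) powr (-\<gamma>) / 2))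
      \<le> (\<Sum>j. ennreal (m j) * inverse (ennreal (\<bar>t - d z (p j)\<bar> powr \<gamma>)))"
    by (intro suminf_le) auto
  moreover have "(\<Sum>j. ennreal (m j * max R (d x (p j)) powr (-\<gamma>) / 2))
      = ennreal ((\<Sum>j. m j * max R (d x (p j)) powr (-\<gamma>)) / 2)"
    using assms m_nonneg potential_summable
    by (subst suminf_ennreal2) (auto intro!: summable_divide simp: suminf_divide)
  moreover have nonneg: "0 \<le> (\<Sum>j. m j * max R (d x (p j)) powr (-\<gamma>)) / 2"
    using assms m_nonneg potential_summable by (simp add: suminf_nonneg)
  moreover have "ennreal (potential x R / 2)
      \<le> ennreal (1 + (\<Sum>j. m j * max R (d x (p j)) powr (-\<gamma>)) / 2)"
    unfolding potential_def by (intro ennreal_leI) (simp add: field_simps)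
  ultimately show ?thesis
    unfolding line_potential_def
    by (subst (asm) ennreal_plus) (auto intro: order_trans add_left_mono)
qed

text \<open>Termwise integration with \<open>nn_integral_inverse_dist_powr\<close> at the poles
  \<open>d x (p j)\<close>. The basepoint being \<open>x\<close> itself, these are exactly the
  distances in \<open>potential x R\<close>. The summand 1 contributes \<open>R\<close>, which is
  absorbed by the same constant.\<close>

lemma nn_integral_line_potential_le:
  assumes "x \<in> M" "0 < R"
  shows "(\<integral>\<^sup>+t\<in>{0..R}. line_potential x t \<partial>lborel) \<le> ennreal (4 / (1 - \<gamma>) * R * potential x R)"
proof -
  define C where "C = 4 / (1 - \<gamma>) * R"
  have C: "R \<le> C" "0 \<le> C"
    using assms \<gamma>_pos \<gamma>_less_1 by (auto simp: C_def field_simps)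
  have "(\<integral>\<^sup>+t\<in>{0..R}. line_potential x t \<partial>lborel)
      = (\<integral>\<^sup>+t. indicator {0..R} t + (\<Sum>j. ennreal (m j)
            * (inverse (ennreal (\<bar>t - d x (p j)\<bar> powr \<gamma>)) * indicator {0..R} t)) \<partial>lborel)"
    by (intro nn_integral_cong) (auto simp: line_potential_def indicator_def)
  also have "\<dots> = ennreal R + (\<Sum>j. ennreal (m j)
        * (\<integral>\<^sup>+t\<in>{0..R}. inverse (ennreal (\<bar>t - d x (p j)\<bar> powr \<gamma>)) \<partial>lborel))"
    using \<open>0 < R\<close> by (simp add: nn_integral_add nn_integral_suminf nn_integral_cmult)
  also have "\<dots> \<le> ennreal C + (\<Sum>j. ennreal (m j) * ennreal (C * max R (d x (p j)) powr (-\<gamma>)))"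
    using nn_integral_inverse_dist_powr[OF \<gamma>_pos \<gamma>_less_1 nonneg \<open>0 < R\<close>] C
    unfolding C_def by (intro add_mono suminf_le mult_left_mono ennreal_leI) auto
  also have "(\<Sum>j. ennreal (m j) * ennreal (C * max R (d x (p j)) powr (-\<gamma>)))
      = (\<Sum>j. ennreal (C * (m j * max R (d x (p j)) powr (-\<gamma>))))"
    using m_nonneg C by (simp add: ennreal_mult[symmetric] mult_ac)
  also have "\<dots> = ennreal (C * (\<Sum>j. m j * max R (d x (p j)) powr (-\<gamma>)))"
    using m_nonneg C potential_summable[OF \<open>0 < R\<close>]
    by (subst suminf_ennreal2) (auto intro!: summable_mult simp: suminf_mult)
  also have "ennreal C + \<dots> = ennreal (C * potential x R)"
    using m_nonneg C potential_summable[OF \<open>0 < R\<close>]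
    by (subst ennreal_plus[symmetric])
      (auto simp: potential_def distrib_left intro!: mult_nonneg_nonneg suminf_nonneg)
  finally show ?thesis unfolding C_def .
qed

section \<open>Bounds for the lengths of the slices\<close>

lemma slice_commute: "slice z x y = slice z y x"
  unfolding slice_def by (simp add: min.commute max.commute)

lemma slice_triangle: "slice z x w \<le> slice z x y + slice z y w"
proof -
  let ?W = "\<lambda>t. inverse (line_potential z t ^ K)"
  let ?I = "\<lambda>x y. {min (d z x) (d z y)..max (d z x) (d z y)}"
  have "slice z x w \<le> (\<integral>\<^sup>+t. ?W t * indicator (?I x y) t + ?W t * indicator (?I y w) t \<partial>lborel)"
    unfolding slice_def by (intro nn_integral_mono) (auto simp: indicator_def)
  also have "\<dots> = slice z x y + slice z y w"
    unfolding slice_def by (intro nn_integral_add) auto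
  finally show ?thesis .
qed

text \<open>The interval of integration has length at most \<open>d x y\<close> and stays within
  \<open>d x y\<close> of \<open>d z x\<close>. Used with \<open>B = 1\<close> for the comparison
  with \<open>d\<close>, and with the potential for the sharp bound.\<close>

lemma slice_le:
  assumes "z \<in> M" "x \<in> M" "y \<in> M" and "0 \<le> B"
    and B: "\<And>t. \<bar>t - d z x\<bar> \<le> d x y \<Longrightarrow> inverse (line_potential z t ^ K) \<le> ennreal B"
  shows "slice z x y \<le> ennreal (B * d x y)"
proof -
  let ?I = "{min (d z x) (d z y)..max (d z x) (d z y)}"
  have I: "\<bar>d z x - d z y\<bar> \<le> d x y"
    using assms triangle[of z x y] triangle[of z y x] commute[of x y] by auto
  have "slice z x y \<le> (\<integral>\<^sup>+t\<in>?I. ennreal B \<partial>lborel)"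
    unfolding slice_def using I by (intro nn_integral_mono) (auto simp: indicator_def intro!: B)
  also have "\<dots> = ennreal B * ennreal (max (d z x) (d z y) - min (d z x) (d z y))"
    by (simp add: nn_integral_cmult)
  also have "\<dots> \<le> ennreal (B * d x y)"
    using I \<open>0 \<le> B\<close> by (auto simp: ennreal_mult[symmetric] intro!: ennreal_leI mult_left_mono)
  finally show ?thesis .
qed

lemma slice_le_dist:
  assumes "z \<in> M" "x \<in> M" "y \<in> M"
  shows "slice z x y \<le> ennreal (d x y)"
proof -
  have "inverse (line_potential z t ^ K) \<le> 1" for t
    using ennreal_inverse_antimono[of 1 "line_potential z t ^ K"] line_potential_ge_1
    by (simp add: one_le_power)
  then show ?thesis
    using slice_le[OF assms, of 1] by simp
qed

lemma slice_upper:
  assumes "z \<in> M" "x \<in> M" "y \<in> M" "x \<noteq> y"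
  shows "slice z x y \<le> ennreal ((2 / potential x (d x y)) ^ K * d x y)"
proof (rule slice_le)
  fix t assume t: "\<bar>t - d z x\<bar> \<le> d x y"
  have R: "0 < d x y" using assms by (simp add: mdist_pos_less)
  note u = potential_ge_1[OF R, of x]
  have "ennreal ((potential x (d x y) / 2) ^ K) \<le> line_potential z t ^ K"
    using power_mono[OF line_potential_ge[OF assms(1,2) R t], of K] u by (simp add: ennreal_power)
  then have "inverse (line_potential z t ^ K) \<le> inverse (ennreal ((potential x (d x y) / 2) ^ K))"
    by (rule ennreal_inverse_antimono)
  also have "\<dots> = ennreal ((2 / potential x (d x y)) ^ K)"
    using u by (simp add: inverse_ennreal power_inverse[symmetric])
  finally show "inverse (line_potential z t ^ K) \<le> ennreal ((2 / potential x (d x y)) ^ K)" .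
qed (use assms potential_ge_1[of "d x y" x] mdist_pos_less[of x y] in auto)

definition lower_const :: real where
  "lower_const = (8 / (1 - \<gamma>)) ^ K * 2"

lemma lower_const_pos: "0 < lower_const"
  using \<gamma>_less_1 by (simp add: lower_const_def)

lemma slice_lower:
  assumes "x \<in> M" "y \<in> M" "x \<noteq> y"
  shows "ennreal (d x y / potential x (d x y) ^ K / lower_const) \<le> slice x x y"
proof -
  define R where "R = d x y"
  \<comment> \<open>Twice the bound \<open>4 / (1 - \<gamma>) * potential x R\<close> for the mean
    of \<open>line_potential x\<close> over \<open>{0..R}\<close>.\<close>
  define l where "l = 8 / (1 - \<gamma>) * potential x R"
  have R: "0 < R" using assms by (simp add: R_def mdist_pos_less)
  note u = potential_ge_1[OF R, of x]
  have l: "0 < l" using u \<gamma>_less_1 by (simp add: l_def)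
  have slice: "slice x x y = (\<integral>\<^sup>+t\<in>{0..R}. inverse (line_potential x t ^ K) \<partial>lborel)"
    using assms R by (simp add: slice_def R_def)
  \<comment> \<open>Chebyshev's argument: integrated over \<open>[0, R]\<close>, the second summand is at most \<open>R / 2\<close>.\<close>
  have cover: "1 \<le> ennreal (l ^ K) * inverse (line_potential x t ^ K) + ennreal (1 / l) * line_potential x t" for t
  proof (cases "line_potential x t \<le> ennreal l")
    case True
    have "1 = ennreal (l ^ K) * inverse (ennreal (l ^ K))"
      using l by (simp add: inverse_ennreal ennreal_mult[symmetric])
    also have "\<dots> \<le> ennreal (l ^ K) * inverse (line_potential x t ^ K)"
      using True l by (intro mult_left_mono ennreal_inverse_antimono)
        (auto simp: ennreal_power[symmetric] intro!: power_mono)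
    finally show ?thesis by (simp add: add_increasing2)
  next
    case False
    have "1 = ennreal (1 / l) * ennreal l"
      using l by (simp add: ennreal_mult[symmetric])
    also have "\<dots> \<le> ennreal (1 / l) * line_potential x t"
      using False by (intro mult_left_mono) auto
    finally show ?thesis by (simp add: add_increasing)
  qed
  have "ennreal R = (\<integral>\<^sup>+t\<in>{0..R}. 1 \<partial>lborel)"
    using R by simp
  also have "\<dots> \<le> (\<integral>\<^sup>+t. ennreal (l ^ K) * (inverse (line_potential x t ^ K) * indicator {0..R} t)
      + ennreal (1 / l) * (line_potential x t * indicator {0..R} t) \<partial>lborel)"
    using cover by (intro nn_integral_mono) (auto simp: indicator_def)
  also have "\<dots> = ennreal (l ^ K) * slice x x y
      + ennreal (1 / l) * (\<integral>\<^sup>+t\<in>{0..R}. line_potential x t \<partial>lborel)"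
    unfolding slice by (simp add: nn_integral_add nn_integral_cmult)
  also have "\<dots> \<le> ennreal (l ^ K) * slice x x y
      + ennreal (1 / l) * ennreal (4 / (1 - \<gamma>) * R * potential x R)"
    using nn_integral_line_potential_le[OF \<open>x \<in> M\<close> R] by (intro add_left_mono mult_left_mono) auto
  also have "ennreal (1 / l) * ennreal (4 / (1 - \<gamma>) * R * potential x R) = ennreal (R / 2)"
    using u \<gamma>_less_1 R by (subst ennreal_mult'[symmetric]) (auto simp: l_def field_simps)
  finally have main: "ennreal R \<le> ennreal (l ^ K) * slice x x y + ennreal (R / 2)" .
  have fin: "slice x x y \<noteq> top"
    using slice_le_dist[of x x y] assms by (auto simp: top_unique)
  define h where "h = enn2real (slice x x y)"
  have h: "slice x x y = ennreal h" "0 \<le> h"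
    using fin by (auto simp: h_def less_top)
  from main have "R \<le> l ^ K * h + R / 2"
    using h l R by (simp add: ennreal_mult[symmetric] ennreal_plus[symmetric] del: ennreal_plus)
  then have "R / (l ^ K * 2) \<le> h"
    using l by (simp add: field_simps)
  moreover have "R / potential x R ^ K / lower_const = R / (l ^ K * 2)"
    by (simp add: l_def lower_const_def power_mult_distrib power_divide)
  ultimately show ?thesis
    unfolding h R_def[symmetric] by (metis ennreal_leI)
qed

section \<open>The deformed metric: comparison, topology and quasisymmetry\<close>

lemma ennreal_deformed:
  assumes "x \<in> M" "y \<in> M"
  shows "ennreal (deformed x y) = (SUP z\<in>M. slice z x y)"
proof -
  have "(SUP z\<in>M. slice z x y) \<le> ennreal (d x y)"
    using assms by (intro SUP_least slice_le_dist)
  then have "(SUP z\<in>M. slice z x y) < top"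
    by (rule le_less_trans) simp
  then show ?thesis
    by (simp add: deformed_def)
qed

lemma deformed_nonneg: "0 \<le> deformed x y"
  by (simp add: deformed_def)

lemma deformed_leI:
  assumes "x \<in> M" "y \<in> M" "0 \<le> B" and "\<And>z. z \<in> M \<Longrightarrow> slice z x y \<le> ennreal B"
  shows "deformed x y \<le> B"
proof -
  have "ennreal (deformed x y) \<le> ennreal B"
    unfolding ennreal_deformed[OF assms(1,2)] by (intro SUP_least assms(4))
  then show ?thesis using \<open>0 \<le> B\<close> by simp
qed

lemma slice_le_deformed:
  assumes "z \<in> M" "x \<in> M" "y \<in> M"
  shows "slice z x y \<le> ennreal (deformed x y)"
  unfolding ennreal_deformed[OF assms(2,3)] using assms(1) by (rule SUP_upper)

lemma deformed_le_dist: "x \<in> M \<Longrightarrow> y \<in> M \<Longrightarrow> deformed x y \<le> d x y"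
  by (rule deformed_leI) (auto intro: slice_le_dist)

lemma deformed_upper:
  assumes "x \<in> M" "y \<in> M" "x \<noteq> y"
  shows "deformed x y \<le> (2 / potential x (d x y)) ^ K * d x y"
  using assms potential_ge_1[of "d x y" x] mdist_pos_less[of x y]
  by (intro deformed_leI slice_upper) auto

lemma deformed_lower:
  assumes "x \<in> M" "y \<in> M" "x \<noteq> y"
  shows "d x y / potential x (d x y) ^ K / lower_const \<le> deformed x y"
proof -
  have "ennreal (d x y / potential x (d x y) ^ K / lower_const) \<le> ennreal (deformed x y)"
    using slice_lower[OF assms] slice_le_deformed[of x x y] assms by (rule_tac order_trans) auto
  then show ?thesis using deformed_nonneg by simp
qed

lemma deformed_lower_pos:
  assumes "x \<in> M" "0 < r"
  shows "0 < r / potential x r ^ K / lower_const"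
  using assms potential_ge_1[of r x] lower_const_pos by simp

lemma deformed_pos:
  assumes "x \<in> M" "y \<in> M" "x \<noteq> y"
  shows "0 < deformed x y"
  using deformed_lower_pos[of x "d x y"] deformed_lower[OF assms] mdist_pos_less[of x y] assms
  by fastforce

lemma Metric_space_deformed: "Metric_space M deformed"
proof
  show "0 \<le> deformed x y" for x y
    by (rule deformed_nonneg)
  show "deformed x y = deformed y x" for x y
    unfolding deformed_def by (simp add: slice_commute)
  show "deformed x y = 0 \<longleftrightarrow> x = y" if "x \<in> M" "y \<in> M" for x y
    using deformed_pos[of x y] deformed_le_dist[of x x] deformed_nonneg[of x x] that
    by force
  show "deformed x w \<le> deformed x y + deformed y w" if "x \<in> M" "y \<in> M" "w \<in> M" for x y w
  proof (rule deformed_leI)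
    fix z assume "z \<in> M"
    then have "slice z x y + slice z y w \<le> ennreal (deformed x y) + ennreal (deformed y w)"
      using that by (intro add_mono slice_le_deformed)
    then show "slice z x w \<le> ennreal (deformed x y + deformed y w)"
      using slice_triangle[of z x w y] by (simp add: deformed_nonneg)
  qed (use that deformed_nonneg in auto)
qed

lemma mball_deformed_subset:
  assumes "x \<in> M" "0 < r"
  shows "\<exists>e>0. Metric_space.mball M deformed x e \<subseteq> mball x r"
proof (intro exI conjI subsetI)
  \<comment> \<open>The lower bound of \<open>deformed_lower\<close> at distance exactly
    \<open>r\<close>. As the potential decreases with the scale, it also bounds the deformed
    distance to every point further away.\<close>
  let ?e = "r / potential x r ^ K / lower_const"
  show "0 < ?e"
    using assms by (rule deformed_lower_pos)
  fix y assume "y \<in> Metric_space.mball M deformed x ?e"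
  then have y: "y \<in> M" "deformed x y < ?e"
    by (auto simp: Metric_space.in_mball[OF Metric_space_deformed])
  have "d x y < r"
  proof (rule ccontr)
    assume far: "\<not> d x y < r"
    then have "x \<noteq> y"
      using assms by auto
    have "?e \<le> d x y / potential x (d x y) ^ K / lower_const"
      using far assms potential_ge_1[of "d x y" x] potential_antimono[of r "d x y" x] lower_const_pos
      by (intro divide_right_mono frac_le power_mono) auto
    also have "\<dots> \<le> deformed x y"
      using assms y \<open>x \<noteq> y\<close> by (intro deformed_lower)
    finally show False using y by simp
  qed
  then show "y \<in> mball x r"
    using assms y by simp
qed

lemma mball_subset_deformed: "mball x r \<subseteq> Metric_space.mball M deformed x r"
  using deformed_le_dist by (force simp: Metric_space.in_mball[OF Metric_space_deformed])

lemma mtopology_deformed: "Metric_space.mtopology M deformed = mtopology"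
  unfolding topology_eq Metric_space.openin_mtopology[OF Metric_space_deformed] openin_mtopology
  using mball_deformed_subset mball_subset_deformed by (meson order_trans subsetD)

lemma mtotally_bounded_deformed:
  "mtotally_bounded M \<Longrightarrow> Metric_space.mtotally_bounded M deformed M"
  unfolding mtotally_bounded_def Metric_space.mtotally_bounded_def[OF Metric_space_deformed]
  using mball_subset_deformed by (meson UN_mono order_refl order_trans)

text \<open>By the two-sided bounds the ratio is \<open>t = d x a / d x b\<close> times the
  \<open>K\<close>-th power of a quotient of potentials at \<open>x\<close>, up to a constant. That
  quotient is at most 1 for \<open>t \<le> 1\<close> and at most \<open>t\<close> otherwise; the sum
  \<open>1 + t ^ K\<close> covers both cases and makes the gauge a single polynomial.\<close>

lemma deformed_ratio_le:
  assumes "x \<in> M" "a \<in> M" "b \<in> M" "x \<noteq> b"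
  shows "deformed x a / deformed x b
    \<le> 2 ^ K * lower_const * (d x a / d x b + (d x a / d x b) ^ Suc K)"
proof (cases "x = a")
  case True
  then have "deformed x a = 0"
    using assms Metric_space.zero[OF Metric_space_deformed] by blast
  then show ?thesis using lower_const_pos by simp
next
  case False
  define r R t where "r = d x a" and "R = d x b" and "t = r / R"
  have rR: "0 < r" "0 < R"
    using assms False by (auto simp: r_def R_def mdist_pos_less)
  have u: "1 \<le> potential x r" "1 \<le> potential x R"
    using rR by (auto intro: potential_ge_1)
  have pot: "(potential x R / potential x r) ^ K \<le> 1 + t ^ K"
  proof (cases "r \<le> R")
    case True
    then have "potential x R / potential x r \<le> 1"
      using potential_antimono[of r R x] rR u by simp
    then have "(potential x R / potential x r) ^ K \<le> 1"
      using u by (intro power_le_one) auto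
    moreover have "0 \<le> t ^ K" using rR by (simp add: t_def)
    ultimately show ?thesis by linarith
  next
    case False
    then have "potential x R / potential x r \<le> t"
      using potential_le_scaled[of R r x] rR u by (simp add: t_def divide_le_eq)
    then have "(potential x R / potential x r) ^ K \<le> t ^ K"
      using u by (intro power_mono) auto
    then show ?thesis by simp
  qed
  have "deformed x a / deformed x b
      \<le> ((2 / potential x r) ^ K * r) / (R / potential x R ^ K / lower_const)"
    using deformed_upper[of x a] deformed_lower[of x b] deformed_lower_pos[of x R] deformed_nonneg
      assms False rR u
    by (intro frac_le) (auto simp: r_def R_def)
  also have "\<dots> = 2 ^ K * lower_const * (t * (potential x R / potential x r) ^ K)"
    using rR u by (simp add: t_def power_divide field_simps)
  also have "\<dots> \<le> 2 ^ K * lower_const * (t * (1 + t ^ K))"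
    using pot lower_const_pos rR by (intro mult_left_mono) (auto simp: t_def)
  finally show ?thesis
    by (simp add: t_def r_def R_def distrib_left)
qed

text \<open>The gain in the covering sets: the \<open>j\<close>-th summand alone makes the potential
  at least \<open>m j * r powr (-\<gamma>)\<close> at scale \<open>r\<close>, and the potential at
  the smaller scale \<open>d x y\<close> is no less.\<close>

lemma deformed_le_near_point:
  assumes "x \<in> M" "y \<in> M" "d x y \<le> r" "d x (p j) \<le> r" "0 < r" "0 < m j"
  shows "deformed x y \<le> (2 / (m j * r powr (-\<gamma>))) ^ K * r"
proof (cases "x = y")
  case True
  then have "deformed x y = 0"
    using assms Metric_space.zero[OF Metric_space_deformed] by blast
  then show ?thesis using assms by simp
next
  case False
  have "m j * r powr (-\<gamma>) \<le> potential x r"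
    using potential_ge_term[of r j x] assms by (simp add: max_def)
  also have "\<dots> \<le> potential x (d x y)"
    using assms False by (intro potential_antimono) (auto simp: mdist_pos_less)
  finally have "2 / potential x (d x y) \<le> 2 / (m j * r powr (-\<gamma>))"
    using assms by (intro frac_le) auto
  then have "(2 / potential x (d x y)) ^ K * d x y \<le> (2 / (m j * r powr (-\<gamma>))) ^ K * r"
    using assms False potential_ge_1[of "d x y" x] mdist_pos_less[of x y]
    by (intro mult_mono power_mono) auto
  then show ?thesis
    using deformed_upper[OF assms(1,2) False] by linarith
qed

end

section \<open>Coverings and the intermediate dimension\<close>

lemma ediam_leI:
  assumes "\<And>x y. x \<in> A \<Longrightarrow> y \<in> A \<Longrightarrow> d x y \<le> r"
  shows "ediam d A \<le> ennreal r"
  unfolding ediam_def using assms by (intro SUP_least) (auto intro: ennreal_leI)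

lemma ediam_ge: "x \<in> A \<Longrightarrow> y \<in> A \<Longrightarrow> ennreal (d x y) \<le> ediam d A"
  unfolding ediam_def by (rule SUP_upper2[of "(x, y)"]) auto

lemma dist_le_enn2real_ediam:
  assumes "ediam d A < top" "x \<in> A" "y \<in> A"
  shows "d x y \<le> enn2real (ediam d A)"
  using enn2real_mono[OF ediam_ge[OF assms(2,3)] assms(1)]
  \<comment> \<open>Here \<open>d\<close> is an arbitrary function, and \<open>ennreal\<close> sends
    its negative values to 0.\<close>
  by (cases "0 \<le> d x y") (auto intro: order_trans[of _ 0])

lemma sum_le_of_infsum_le_ennreal:
  assumes "(\<Sum>\<^sub>\<infinity>i\<in>I. ennreal (g i)) \<le> ennreal e" "0 \<le> e" "\<And>i. i \<in> I \<Longrightarrow> 0 \<le> g i"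
    and "finite F" "F \<subseteq> I"
  shows "(\<Sum>i\<in>F. g i) \<le> e"
proof -
  have "ennreal (\<Sum>i\<in>F. g i) = (\<Sum>i\<in>F. ennreal (g i))"
    using assms by (intro sum_ennreal[symmetric]) auto
  also have "\<dots> \<le> (\<Sum>\<^sub>\<infinity>i\<in>I. ennreal (g i))"
    using assms by (subst nonneg_infsum_complete) (auto intro!: SUP_upper)
  finally show ?thesis using assms by (metis ennreal_le_iff order_trans)
qed

lemma infsum_ennreal_leI:
  assumes "\<And>i. i \<in> I \<Longrightarrow> 0 \<le> g i"
    and "\<And>F. finite F \<Longrightarrow> F \<subseteq> I \<Longrightarrow> (\<Sum>i\<in>F. g i) \<le> e"
  shows "(\<Sum>\<^sub>\<infinity>i\<in>I. ennreal (g i)) \<le> ennreal e"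
proof -
  have "(\<Sum>i\<in>F. ennreal (g i)) \<le> ennreal e" if "finite F" "F \<subseteq> I" for F
  proof -
    have "(\<Sum>i\<in>F. ennreal (g i)) = ennreal (\<Sum>i\<in>F. g i)"
      using assms that by (intro sum_ennreal) auto
    then show ?thesis using assms that by (simp add: ennreal_leI)
  qed
  then show ?thesis
    by (subst nonneg_infsum_complete) (auto intro: SUP_least)
qed

lemma upper_intermediate_dim_nonneg: "0 \<le> upper_intermediate_dim Y d \<theta>"
proof -
  have "0 \<le> upper_intermediate_dim_in Z dZ E \<theta>" for Z :: "(nat \<Rightarrow>\<^sub>C real) set" and dZ E
    unfolding upper_intermediate_dim_in_def by (rule Inf_greatest) auto
  then show ?thesis
    unfolding upper_intermediate_dim_def by (auto simp: Let_def split: prod.split)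
qed

text \<open>The ambient space is an unspecified choice, so all later arguments may use only the
  properties collected in \<open>ambient_space\<close>.\<close>

lemma upper_intermediate_dim_ambient:
  assumes "Metric_space X d" "Metric_space.mtotally_bounded X d X"
  obtains Z dZ f where "ambient_space X d (Z, dZ, f)"
    and "upper_intermediate_dim X d \<theta> = upper_intermediate_dim_in Z dZ (f ` X) \<theta>"
proof -
  obtain Z dZ f where p: "(SOME p. ambient_space X d p) = (Z, dZ, f)"
    by (metis prod_cases3)
  have "ambient_space X d (Z, dZ, f)"
    using someI_ex[OF ambient_space_exists[OF assms]] by (simp add: p)
  moreover have "upper_intermediate_dim X d \<theta> = upper_intermediate_dim_in Z dZ (f ` X) \<theta>"
    by (simp add: upper_intermediate_dim_def p)
  ultimately show ?thesis using that by blast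
qed

text \<open>Coverings by subsets of the ambient space are pulled back to \<open>X\<close>. The
  number \<open>r i\<close> remains the diameter of the original set, since the trace on
  \<open>X\<close> may be too small for the lower end of the window. The bound 1 on the sums
  suffices, because summability over all scales is gained later by raising the exponent.\<close>

lemma coverings_of_upper_intermediate_dim_less:
  assumes "Metric_space X d" "Metric_space.mtotally_bounded X d X"
    and "upper_intermediate_dim X d \<theta> < ereal u"
  obtains s \<delta>\<^sub>0 where "0 < s" "s < u" "0 < \<delta>\<^sub>0"
    and "\<forall>\<delta>. 0 < \<delta> \<and> \<delta> \<le> \<delta>\<^sub>0 \<longrightarrow> (\<exists>(I :: nat set) A r.
      (\<forall>i\<in>I. A i \<subseteq> X \<and> A i \<noteq> {} \<and> \<delta> powr (1 / \<theta>) \<le> r i \<and> r i \<le> \<delta> \<and>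
         (\<forall>x\<in>A i. \<forall>y\<in>A i. d x y \<le> r i)) \<and>
      X \<subseteq> (\<Union>i\<in>I. A i) \<and> (\<forall>F. finite F \<and> F \<subseteq> I \<longrightarrow> (\<Sum>i\<in>F. r i powr s) \<le> 1))"
proof -
  obtain Z dZ f where amb: "ambient_space X d (Z, dZ, f)"
    and dim: "upper_intermediate_dim X d \<theta> = upper_intermediate_dim_in Z dZ (f ` X) \<theta>"
    using upper_intermediate_dim_ambient[OF assms(1,2)] by blast
  have iso: "dZ (f x) (f y) = d x y" if "x \<in> X" "y \<in> X" for x y
    using amb that by (auto simp: ambient_space_def isometric_embedding_def)
  define P where "P s \<epsilon> \<delta> \<longleftrightarrow> (\<exists>(I :: nat set) A.
          (\<forall>i\<in>I. A i \<subseteq> Z \<and>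
             ennreal (\<delta> powr (1 / \<theta>)) \<le> ediam dZ (A i) \<and> ediam dZ (A i) \<le> ennreal \<delta>) \<and>
          f ` X \<subseteq> (\<Union>i\<in>I. A i) \<and>
          (\<Sum>\<^sub>\<infinity>i\<in>I. ennreal (enn2real (ediam dZ (A i)) powr s)) < ennreal \<epsilon>)" for s \<epsilon> \<delta>
  have "\<exists>v\<in>ereal ` {s. 0 < s \<and> (\<forall>\<epsilon>>0. \<exists>\<delta>\<^sub>0>0. \<forall>\<delta>. 0 < \<delta> \<and> \<delta> \<le> \<delta>\<^sub>0 \<longrightarrow> P s \<epsilon> \<delta>)}. v < ereal u"
    using assms(3) unfolding dim upper_intermediate_dim_in_def Inf_less_iff P_def .
  then obtain s where s: "0 < s" "s < u"
    and P: "\<forall>\<epsilon>>0. \<exists>\<delta>\<^sub>0>0. \<forall>\<delta>. 0 < \<delta> \<and> \<delta> \<le> \<delta>\<^sub>0 \<longrightarrow> P s \<epsilon> \<delta>"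
    by auto
  obtain \<delta>\<^sub>0 where \<delta>\<^sub>0: "0 < \<delta>\<^sub>0" "\<And>\<delta>. 0 < \<delta> \<Longrightarrow> \<delta> \<le> \<delta>\<^sub>0 \<Longrightarrow> P s 1 \<delta>"
    using P[THEN spec, THEN mp, OF zero_less_one] by blast
  have "\<exists>(I :: nat set) A r.
      (\<forall>i\<in>I. A i \<subseteq> X \<and> A i \<noteq> {} \<and> \<delta> powr (1 / \<theta>) \<le> r i \<and> r i \<le> \<delta> \<and>
         (\<forall>x\<in>A i. \<forall>y\<in>A i. d x y \<le> r i)) \<and>
      X \<subseteq> (\<Union>i\<in>I. A i) \<and> (\<forall>F. finite F \<and> F \<subseteq> I \<longrightarrow> (\<Sum>i\<in>F. r i powr s) \<le> 1)"
    if \<delta>: "0 < \<delta>" "\<delta> \<le> \<delta>\<^sub>0" for \<delta>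
  proof -
    from \<delta>\<^sub>0(2)[OF \<delta>] obtain I :: "nat set" and A
      where all: "\<forall>i\<in>I. A i \<subseteq> Z \<and> ennreal (\<delta> powr (1 / \<theta>)) \<le> ediam dZ (A i) \<and>
          ediam dZ (A i) \<le> ennreal \<delta>"
        and sub: "f ` X \<subseteq> (\<Union>i\<in>I. A i)"
        and sum: "(\<Sum>\<^sub>\<infinity>i\<in>I. ennreal (enn2real (ediam dZ (A i)) powr s)) < ennreal 1"
      unfolding P_def by (elim exE conjE)
    have A: "ennreal (\<delta> powr (1 / \<theta>)) \<le> ediam dZ (A i)" "ediam dZ (A i) \<le> ennreal \<delta>"
      if "i \<in> I" for i
      using all that by blast+
    define r where "r i = enn2real (ediam dZ (A i))" for i
    define B where "B i = {x \<in> X. f x \<in> A i}" for i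
    \<comment> \<open>Empty traces are discarded, so that a point can be chosen in each remaining
      set.\<close>
    define J where "J = {i \<in> I. B i \<noteq> {}}"
    have fin: "ediam dZ (A i) < top" if "i \<in> I" for i
      using A(2)[OF that] by (rule le_less_trans) simp
    show ?thesis
    proof (intro exI conjI ballI allI impI)
      fix i assume "i \<in> J"
      then have i: "i \<in> I" "B i \<noteq> {}"
        by (auto simp: J_def)
      show "B i \<subseteq> X" "B i \<noteq> {}"
        using i by (auto simp: B_def)
      show "\<delta> powr (1 / \<theta>) \<le> r i"
        using enn2real_mono[OF A(1)[OF i(1)] fin[OF i(1)]] by (simp add: r_def)
      show "r i \<le> \<delta>"
        using enn2real_mono[OF A(2)[OF i(1)]] \<delta> by (simp add: r_def)
      show "d x y \<le> r i" if "x \<in> B i" "y \<in> B i" for x y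
        using dist_le_enn2real_ediam[OF fin[OF i(1)], of "f x" "f y"] iso[of x y] that
        by (auto simp: r_def B_def)
    next
      show "X \<subseteq> (\<Union>i\<in>J. B i)"
        using sub by (force simp: J_def B_def)
    next
      fix F assume "finite F \<and> F \<subseteq> J"
      then show "(\<Sum>i\<in>F. r i powr s) \<le> 1"
        using sum unfolding r_def J_def
        by (intro sum_le_of_infsum_le_ennreal[of "\<lambda>i. enn2real (ediam dZ (A i)) powr s" I]) auto
    qed
  qed
  then show ?thesis
    by (intro that[OF s \<delta>\<^sub>0(1)] allI impI) simp_all
qed

text \<open>Converse passage: coverings of \<open>X\<close> at geometric scales, in the window only
  up to constants and with only upper bounds on diameters. They are replaced by balls of the ambient
  space, whose diameters are bounded below by uniform perfectness. The changes of scale and radius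
  cost a constant factor, which \<open>e\<close> tending to 0 absorbs.\<close>

lemma upper_intermediate_dim_le:
  fixes A :: "nat \<Rightarrow> nat \<Rightarrow> 'a set" and \<rho> :: "nat \<Rightarrow> nat \<Rightarrow> real" and I :: "nat \<Rightarrow> nat set"
  assumes X: "Metric_space X d" "Metric_space.mtotally_bounded X d X"
    and \<theta>: "0 < \<theta>" "\<theta> < 1" and "0 < t" and q: "0 < q" "q < 1" and "0 < b" "0 < C"
    and \<rho>_ge: "\<And>n i. i \<in> I n \<Longrightarrow> b * (q ^ n) powr (1 / \<theta>) \<le> \<rho> n i"
    and \<rho>_le: "\<And>n i. i \<in> I n \<Longrightarrow> \<rho> n i \<le> C * q ^ n"
    and diam: "\<And>n i x y. i \<in> I n \<Longrightarrow> x \<in> A n i \<Longrightarrow> y \<in> A n i \<Longrightarrow> d x y \<le> \<rho> n i"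
    and A: "\<And>n i. i \<in> I n \<Longrightarrow> A n i \<subseteq> X \<and> A n i \<noteq> {}"
    and cover: "\<And>n. X \<subseteq> (\<Union>i\<in>I n. A n i)"
    and sums: "\<And>n F. finite F \<Longrightarrow> F \<subseteq> I n \<Longrightarrow> (\<Sum>i\<in>F. \<rho> n i powr t) \<le> e n"
    and e: "e \<longlonglongrightarrow> 0"
  shows "upper_intermediate_dim X d \<theta> \<le> ereal t"
proof -
  obtain Z dZ f where amb: "ambient_space X d (Z, dZ, f)"
    and dim: "upper_intermediate_dim X d \<theta> = upper_intermediate_dim_in Z dZ (f ` X) \<theta>"
    using upper_intermediate_dim_ambient[OF X] by blast
  have iso: "dZ (f x) (f y) = d x y" and fZ: "f x \<in> Z" if "x \<in> X" "y \<in> X" for x y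
    using amb that by (auto simp: ambient_space_def isometric_embedding_def)
  interpret Z: Metric_space Z dZ
    using amb by (auto simp: ambient_space_def uniformly_perfect_def)
  obtain c where c: "0 < c" "c < 1"
    and perfect: "\<And>z r. z \<in> Z \<Longrightarrow> 0 < r \<Longrightarrow> ennreal r < ediam dZ Z \<Longrightarrow>
       Z.mcball z r - Z.mcball z (c * r) \<noteq> {}"
    using amb by (auto simp: ambient_space_def uniformly_perfect_def)
  obtain z z' where z: "z \<in> Z" "z' \<in> Z" "z \<noteq> z'"
    using amb by (auto simp: ambient_space_def)
  define D where "D = dZ z z'"
  have D: "0 < D" "ennreal D \<le> ediam dZ Z"
    using z by (auto simp: D_def Z.mdist_pos_less ediam_ge)
  define \<theta>' where "\<theta>' = 1 / \<theta>"
  have \<theta>': "1 < \<theta>'" using \<theta> by (simp add: \<theta>'_def)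
  \<comment> \<open>Obtained from the lower bound on \<open>\<rho>\<close> through
    \<open>q ^ n \<ge> q * \<delta> / (2 * C)\<close>.\<close>
  define b' where "b' = b * (q / (2 * C)) powr \<theta>'"
  have b': "0 < b'" using \<open>0 < b\<close> \<open>0 < C\<close> q by (simp add: b'_def)
  define B where "B = max 1 (1 / (c * b'))"
  have B: "1 \<le> B" "1 / (c * b') \<le> B" by (auto simp: B_def)
  have "\<exists>\<delta>\<^sub>0>0. \<forall>\<delta>. 0 < \<delta> \<and> \<delta> \<le> \<delta>\<^sub>0 \<longrightarrow>
       (\<exists>(I :: nat set) A.
          (\<forall>i\<in>I. A i \<subseteq> Z \<and>
             ennreal (\<delta> powr (1 / \<theta>)) \<le> ediam dZ (A i) \<and> ediam dZ (A i) \<le> ennreal \<delta>) \<and>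
          f ` X \<subseteq> (\<Union>i\<in>I. A i) \<and>
          (\<Sum>\<^sub>\<infinity>i\<in>I. ennreal (enn2real (ediam dZ (A i)) powr t)) < ennreal \<epsilon>)"
    if "0 < \<epsilon>" for \<epsilon>
  proof -
    have "\<forall>\<^sub>F n in sequentially. e n < \<epsilon> / (2 * B) powr t"
      using e \<open>0 < \<epsilon>\<close> B by (intro order_tendstoD) auto
    then obtain N where N: "\<And>n. N \<le> n \<Longrightarrow> (2 * B) powr t * e n < \<epsilon>"
      using B by (force simp: eventually_sequentially field_simps)
    \<comment> \<open>\<open>D\<close> keeps the radii below the diameter of \<open>Z\<close>; the
      power of \<open>c / 2\<close> yields
      \<open>\<delta> powr \<theta>' \<le> c * (\<delta> / 2)\<close>, as
      \<open>\<theta>' > 1\<close>; and \<open>C * q ^ N\<close> forces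
      \<open>n > N\<close>.\<close>
    define \<delta>\<^sub>0 where "\<delta>\<^sub>0 = min (min D ((c / 2) powr (1 / (\<theta>' - 1)))) (C * q ^ N)"
    have pos: "0 < \<delta>\<^sub>0"
      using D c \<open>0 < C\<close> q by (simp add: \<delta>\<^sub>0_def)
    have cov: "\<exists>(J :: nat set) E.
          (\<forall>i\<in>J. E i \<subseteq> Z \<and>
             ennreal (\<delta> powr \<theta>') \<le> ediam dZ (E i) \<and> ediam dZ (E i) \<le> ennreal \<delta>) \<and>
          f ` X \<subseteq> (\<Union>i\<in>J. E i) \<and>
          (\<Sum>\<^sub>\<infinity>i\<in>J. ennreal (enn2real (ediam dZ (E i)) powr t)) < ennreal \<epsilon>"
      if \<delta>: "0 < \<delta>" "\<delta> \<le> \<delta>\<^sub>0" for \<delta>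
    proof -
      have "\<exists>n. C * q ^ n \<le> \<delta> / 2"
      proof -
        obtain n where "q ^ n < \<delta> / (2 * C)"
          using real_arch_pow_inv[of "\<delta> / (2 * C)" q] \<delta> \<open>0 < C\<close> q by auto
        then show ?thesis using \<open>0 < C\<close> by (intro exI[of _ n]) (simp add: field_simps)
      qed
      then obtain n where n: "C * q ^ n \<le> \<delta> / 2" and least: "\<And>k. k < n \<Longrightarrow> \<not> C * q ^ k \<le> \<delta> / 2"
        using exists_least_iff[of "\<lambda>n. C * q ^ n \<le> \<delta> / 2"] by blast
      have "C * q ^ n < C * q ^ N"
        using n \<delta> by (simp add: \<delta>\<^sub>0_def)
      then have "N < n"
        using \<open>0 < C\<close> q by (simp add: power_strict_decreasing_iff)
      then obtain k where k: "n = Suc k"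
        by (cases n) auto
      \<comment> \<open>Minimality of \<open>n\<close>, applied to its predecessor \<open>k\<close>,
        makes \<open>q ^ n\<close> comparable to \<open>\<delta>\<close>.\<close>
      have qn: "q * \<delta> / (2 * C) \<le> q ^ n"
        using least[of k] k \<open>0 < C\<close> q by (simp add: field_simps)
      have \<rho>_b': "b' * \<delta> powr \<theta>' \<le> \<rho> n i" if "i \<in> I n" for i
      proof -
        have "b' * \<delta> powr \<theta>' = b * (q * \<delta> / (2 * C)) powr \<theta>'"
          using powr_mult[of "q / (2 * C)" \<delta> \<theta>'] by (simp add: b'_def)
        also have "\<dots> \<le> b * (q ^ n) powr \<theta>'"
          using qn \<theta>' \<open>0 < b\<close> \<open>0 < C\<close> q \<delta> by (intro mult_left_mono powr_mono2) auto
        also have "\<dots> \<le> \<rho> n i"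
          using \<rho>_ge[OF that] by (simp add: \<theta>'_def)
        finally show ?thesis .
      qed
      have small: "\<delta> powr \<theta>' \<le> c * (\<delta> / 2)"
      proof -
        have "\<delta> powr (\<theta>' - 1) \<le> ((c / 2) powr (1 / (\<theta>' - 1))) powr (\<theta>' - 1)"
          using \<delta> \<theta>' by (intro powr_mono2) (auto simp: \<delta>\<^sub>0_def)
        also have "\<dots> = c / 2"
          using \<theta>' c by (simp add: powr_powr)
        finally have "\<delta> * \<delta> powr (\<theta>' - 1) \<le> \<delta> * (c / 2)"
          using \<delta> by (intro mult_left_mono) auto
        then show ?thesis
          using \<delta> powr_add[of \<delta> 1 "\<theta>' - 1"] by (simp add: mult_ac)
      qed
      \<comment> \<open>Enlarged so that \<open>c * R i \<ge> \<delta> powr \<theta>'\<close>, the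
        lower end of the window; the enlargement is by at most the factor \<open>B\<close>.\<close>
      define R where "R i = max (\<rho> n i) (\<delta> powr \<theta>' / c)" for i
      define a where "a i = (SOME x. x \<in> A n i)" for i
      define E where "E i = Z.mcball (f (a i)) (R i)" for i
      have \<rho>_pos: "0 < \<rho> n i" if "i \<in> I n" for i
        using \<rho>_b'[OF that] b' \<delta> by (auto intro: less_le_trans[of 0 "b' * \<delta> powr \<theta>'"])
      have R_pos: "0 < R i" for i
        using \<delta> c by (simp add: R_def less_max_iff_disj)
      have R_le: "R i \<le> \<delta> / 2" if "i \<in> I n" for i
        using \<rho>_le[OF that] n small c unfolding R_def
        by (intro max.boundedI) (simp_all add: field_simps)
      have R_le_B: "R i \<le> B * \<rho> n i" if "i \<in> I n" for i
      proof -
        have "\<delta> powr \<theta>' / c \<le> 1 / (c * b') * \<rho> n i"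
          using \<rho>_b'[OF that] b' c by (simp add: field_simps)
        then show ?thesis
          using B \<rho>_pos[OF that] mult_right_mono[OF B(1), of "\<rho> n i"] mult_right_mono[OF B(2), of "\<rho> n i"]
          by (simp add: R_def)
      qed
      have a: "a i \<in> A n i" "a i \<in> X" "f (a i) \<in> Z" if "i \<in> I n" for i
        using A[OF that] some_in_eq[of "A n i"] fZ by (auto simp: a_def)
      have E_dist: "dZ x y \<le> 2 * R i" if "x \<in> E i" "y \<in> E i" for i x y
        using that Z.triangle[of x "f (a i)" y] Z.commute[of x "f (a i)"] by (auto simp: E_def)
      have E_ediam: "ediam dZ (E i) \<le> ennreal (2 * R i)" for i
        by (intro ediam_leI E_dist)
      show ?thesis
      proof (intro exI conjI ballI)
        fix i assume i: "i \<in> I n"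
        show "E i \<subseteq> Z" by (auto simp: E_def)
        show "ediam dZ (E i) \<le> ennreal \<delta>"
          using E_ediam[of i] R_le[OF i] by (rule_tac order_trans) (auto intro: ennreal_leI)
        have "ennreal (R i) < ediam dZ Z"
          using D R_le[OF i] \<delta> R_pos[of i]
          by (intro less_le_trans[OF _ D(2)]) (auto simp: \<delta>\<^sub>0_def ennreal_less_iff)
        \<comment> \<open>The centre and \<open>w\<close> are at distance more than
          \<open>c * R i\<close>, which bounds the diameter of the ball from below.\<close>
        then obtain w where "w \<in> E i - Z.mcball (f (a i)) (c * R i)"
          using perfect[OF a(3)[OF i] R_pos] unfolding E_def by blast
        then have w: "w \<in> E i" "c * R i < dZ (f (a i)) w"
          using a(3)[OF i] by (auto simp: E_def)
        have "\<delta> powr \<theta>' \<le> c * R i"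
          using c mult_left_mono[of "\<delta> powr \<theta>' / c" "R i" c] by (simp add: R_def)
        then have "ennreal (\<delta> powr \<theta>') \<le> ennreal (dZ (f (a i)) w)"
          using w by (intro ennreal_leI) simp
        also have "\<dots> \<le> ediam dZ (E i)"
          using w a(3)[OF i] R_pos[of i] by (intro ediam_ge) (auto simp: E_def)
        finally show "ennreal (\<delta> powr \<theta>') \<le> ediam dZ (E i)" .
      next
        show "f ` X \<subseteq> (\<Union>i\<in>I n. E i)"
        proof
          fix y assume "y \<in> f ` X"
          then obtain x where x: "x \<in> X" "y = f x" by blast
          then obtain i where i: "i \<in> I n" "x \<in> A n i" using cover by blast
          have "dZ (f (a i)) (f x) \<le> R i"
            using diam[OF i(1) a(1)[OF i(1)] i(2)] iso[OF a(2)[OF i(1)] x(1)] by (simp add: R_def)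
          then show "y \<in> (\<Union>i\<in>I n. E i)"
            using x i a(3)[OF i(1)] fZ[of x x] by (auto simp: E_def)
        qed
      next
        have "(\<Sum>\<^sub>\<infinity>i\<in>I n. ennreal (enn2real (ediam dZ (E i)) powr t)) \<le> ennreal ((2 * B) powr t * e n)"
        proof (rule infsum_ennreal_leI)
          fix F assume F: "finite F" "F \<subseteq> I n"
          have "(\<Sum>i\<in>F. enn2real (ediam dZ (E i)) powr t) \<le> (\<Sum>i\<in>F. (2 * B) powr t * \<rho> n i powr t)"
          proof (rule sum_mono)
            fix i assume "i \<in> F"
            then have i: "i \<in> I n" using F by blast
            have "enn2real (ediam dZ (E i)) \<le> 2 * R i"
              using enn2real_mono[OF E_ediam[of i]] R_pos[of i] by simp
            also have "\<dots> \<le> 2 * B * \<rho> n i"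
              using R_le_B[OF i] by simp
            finally have "enn2real (ediam dZ (E i)) powr t \<le> (2 * B * \<rho> n i) powr t"
              using \<open>0 < t\<close> by (intro powr_mono2) auto
            then show "enn2real (ediam dZ (E i)) powr t \<le> (2 * B) powr t * \<rho> n i powr t"
              by (simp add: powr_mult)
          qed
          also have "\<dots> \<le> (2 * B) powr t * e n"
            using sums[OF F] by (simp add: sum_distrib_left[symmetric] mult_left_mono)
          finally show "(\<Sum>i\<in>F. enn2real (ediam dZ (E i)) powr t) \<le> (2 * B) powr t * e n" .
        qed simp
        also have "\<dots> < ennreal \<epsilon>"
          using N[of n] \<open>N < n\<close> \<open>0 < \<epsilon>\<close> by (intro ennreal_lessI) auto
        finally show "(\<Sum>\<^sub>\<infinity>i\<in>I n. ennreal (enn2real (ediam dZ (E i)) powr t)) < ennreal \<epsilon>" .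
      qed
    qed
    show ?thesis
    proof (intro exI[of _ \<delta>\<^sub>0] conjI allI impI)
      fix \<delta> assume "0 < \<delta> \<and> \<delta> \<le> \<delta>\<^sub>0"
      then show "\<exists>(J :: nat set) E.
          (\<forall>i\<in>J. E i \<subseteq> Z \<and>
             ennreal (\<delta> powr (1 / \<theta>)) \<le> ediam dZ (E i) \<and> ediam dZ (E i) \<le> ennreal \<delta>) \<and>
          f ` X \<subseteq> (\<Union>i\<in>J. E i) \<and>
          (\<Sum>\<^sub>\<infinity>i\<in>J. ennreal (enn2real (ediam dZ (E i)) powr t)) < ennreal \<epsilon>"
        by (intro cov[unfolded \<theta>'_def]) simp_all
    qed (rule pos)
  qed
  then show ?thesis
    unfolding dim upper_intermediate_dim_in_def using \<open>0 < t\<close> by (intro Inf_lower imageI) auto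
qed

section \<open>Quasisymmetry and the conformal dimension\<close>

lemma homeomorphic_map_power_gauge:
  fixes C :: real
  assumes "0 < C"
  shows "homeomorphic_map (top_of_set {0..}) (top_of_set {0..}) (\<lambda>t. C * (t + t ^ Suc K))"
    and "strict_mono_on {0..} (\<lambda>t. C * (t + t ^ Suc K))"
proof -
  let ?\<eta> = "\<lambda>t. C * (t + t ^ Suc K)"
  have cont: "continuous_on A ?\<eta>" for A
    by (intro continuous_intros)
  show mono: "strict_mono_on {0..} ?\<eta>"
    using assms by (intro strict_mono_onI mult_strict_left_mono add_strict_mono power_strict_mono) auto
  have "?\<eta> ` {0..} = {0..}"
  proof (intro equalityI subsetI)
    fix y :: real assume "y \<in> {0..}"
    \<comment> \<open>The linear summand alone reaches \<open>y\<close> at \<open>y / C\<close>,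
      which gives the right endpoint for the intermediate value theorem.\<close>
    moreover have "y \<le> ?\<eta> (y / C)" if "0 \<le> y"
      using that assms by (simp add: distrib_left)
    ultimately have "\<exists>t. 0 \<le> t \<and> t \<le> y / C \<and> ?\<eta> t = y"
      using assms cont by (intro IVT') auto
    then show "y \<in> ?\<eta> ` {0..}" by auto
  qed (use assms in auto)
  then obtain g where "homeomorphism {0..} {0..} ?\<eta> g"
    using homeomorphism_into_1d[OF _ cont _ strict_mono_on_imp_inj_on[OF mono]]
    by (metis convex_imp_path_connected convex_real_interval(1))
  then show "homeomorphic_map (top_of_set {0..}) (top_of_set {0..}) ?\<eta>"
    unfolding homeomorphic_map_maps homeomorphic_maps_def homeomorphism_def
    by (auto intro!: exI[of _ g] simp del: power_Suc)
qed

lemma conformal_upper_intermediate_dim_le: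
  fixes X Y :: "'a set"
  assumes "Metric_space Y d'" "quasisymmetrically_equivalent X d Y d'"
    and "upper_intermediate_dim Y d' \<theta> \<le> t"
  shows "conformal_upper_intermediate_dim X d \<theta> \<le> t"
proof -
  have "upper_intermediate_dim Y d' \<theta> \<in> {upper_intermediate_dim Y d' \<theta> | (Y :: 'a set) d'.
      Metric_space Y d' \<and> quasisymmetrically_equivalent X d Y d'}"
    using assms(1,2) by (intro CollectI exI[of _ Y] exI[of _ d'] conjI refl)
  then show ?thesis
    unfolding conformal_upper_intermediate_dim_def using assms(3) by (rule Inf_lower2)
qed

lemma conformal_upper_intermediate_dim_nonneg: "0 \<le> conformal_upper_intermediate_dim X d \<theta>"
  unfolding conformal_upper_intermediate_dim_def
  by (intro Inf_greatest) (auto simp: upper_intermediate_dim_nonneg)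

lemma (in metric_potential) quasisymmetrically_equivalent_deformed:
  "quasisymmetrically_equivalent M d M deformed"
  unfolding quasisymmetrically_equivalent_def
proof (intro exI conjI ballI impI)
  let ?C = "2 ^ K * lower_const"
  have C: "0 < ?C" using lower_const_pos by simp
  show "homeomorphic_map mtopology (Metric_space.mtopology M deformed) id"
    by (simp add: mtopology_deformed)
  show "homeomorphic_map (top_of_set {0..}) (top_of_set {0..}) (\<lambda>t. ?C * (t + t ^ Suc K))"
    and "strict_mono_on {0..} (\<lambda>t. ?C * (t + t ^ Suc K))"
    using C by (rule homeomorphic_map_power_gauge)+
  show "deformed (id x) (id a) / deformed (id x) (id b) \<le> ?C * (d x a / d x b + (d x a / d x b) ^ Suc K)"
    if "x \<in> M" "a \<in> M" "b \<in> M" "x \<noteq> b" for x a b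
    using deformed_ratio_le[OF that] by simp
qed

lemma quasisymmetrically_equivalent_empty: "quasisymmetrically_equivalent {} d {} d"
  unfolding quasisymmetrically_equivalent_def
  by (intro exI[of _ id] conjI) (auto simp: strict_mono_on_def)

text \<open>The code of a pair is at least as large as both components, so the first
  \<open>k\<close> pairs lie in a \<open>k\<close> by \<open>k\<close> square, whose row sums form a
  geometric series.\<close>

lemma summable_double_powers:
  fixes g :: "nat \<Rightarrow> nat \<Rightarrow> real"
  assumes "\<And>n i. 0 \<le> g n i" "0 \<le> w" "w < 1" and "\<And>n F. finite F \<Longrightarrow> (\<Sum>i\<in>F. g n i) \<le> w ^ n"
  shows "summable (\<lambda>j. case prod_decode j of (n, i) \<Rightarrow> g n i)"
proof (rule summableI_nonneg_bounded)
  show "0 \<le> (case prod_decode j of (n, i) \<Rightarrow> g n i)" for j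
    using assms(1) by (simp split: prod.split)
  fix k
  have "prod_decode ` {..<k} \<subseteq> {..<k} \<times> {..<k}"
  proof
    fix v assume "v \<in> prod_decode ` {..<k}"
    then obtain n i where v: "v = (n, i)" "prod_encode (n, i) < k"
      by (metis imageE lessThan_iff prod.exhaust prod_decode_inverse)
    then show "v \<in> {..<k} \<times> {..<k}"
      using le_prod_encode_1[of n i] le_prod_encode_2[of i n] by auto
  qed
  moreover have "(\<Sum>j<k. case prod_decode j of (n, i) \<Rightarrow> g n i)
      = (\<Sum>(n, i)\<in>prod_decode ` {..<k}. g n i)"
    by (subst sum.reindex) (simp_all add: inj_prod_decode o_def)
  ultimately have "(\<Sum>j<k. case prod_decode j of (n, i) \<Rightarrow> g n i)
      \<le> (\<Sum>(n, i)\<in>{..<k} \<times> {..<k}. g n i)"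
    using assms(1) by (auto intro!: sum_mono2)
  also have "\<dots> = (\<Sum>n<k. \<Sum>i<k. g n i)"
    by (simp add: sum.cartesian_product)
  also have "\<dots> \<le> (\<Sum>n<k. w ^ n)"
    by (intro sum_mono assms(4)) simp
  also have "\<dots> \<le> (\<Sum>n. w ^ n)"
    using assms by (intro sum_le_suminf) (auto intro: summable_geometric)
  finally show "(\<Sum>j<k. case prod_decode j of (n, i) \<Rightarrow> g n i) \<le> (\<Sum>n. w ^ n)" .
qed

lemma conformal_upper_intermediate_dim_le_pos:
  fixes X :: "'a set"
  assumes X: "Metric_space X d" "Metric_space.mtotally_bounded X d X"
    and \<theta>: "0 < \<theta>" "\<theta> < 1" and dim: "upper_intermediate_dim X d \<theta> < 1" and t: "0 < t"
    and "X \<noteq> {}"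
  shows "conformal_upper_intermediate_dim X d \<theta> \<le> ereal t"
proof -
  obtain x0 where x0: "x0 \<in> X" using \<open>X \<noteq> {}\<close> by blast
  from dim have "upper_intermediate_dim X d \<theta> < ereal 1"
    by (simp add: one_ereal_def)
  then obtain s \<delta>\<^sub>0 where s: "0 < s" "s < 1" and \<delta>\<^sub>0: "0 < \<delta>\<^sub>0"
    and cov: "\<forall>\<delta>. 0 < \<delta> \<and> \<delta> \<le> \<delta>\<^sub>0 \<longrightarrow> (\<exists>(I :: nat set) A r.
      (\<forall>i\<in>I. A i \<subseteq> X \<and> A i \<noteq> {} \<and> \<delta> powr (1 / \<theta>) \<le> r i \<and> r i \<le> \<delta> \<and>
         (\<forall>x\<in>A i. \<forall>y\<in>A i. d x y \<le> r i)) \<and>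
      X \<subseteq> (\<Union>i\<in>I. A i) \<and> (\<forall>F. finite F \<and> F \<subseteq> I \<longrightarrow> (\<Sum>i\<in>F. r i powr s) \<le> 1))"
    by (rule coverings_of_upper_intermediate_dim_less[OF X])
  \<comment> \<open>The bound 1 makes all \<open>r n i \<le> 1\<close>, so that larger exponents
    give smaller powers.\<close>
  define \<delta>\<^sub>1 where "\<delta>\<^sub>1 = min \<delta>\<^sub>0 1"
  define \<delta> where "\<delta> n = \<delta>\<^sub>1 * (1 / 2) ^ n" for n :: nat
  have \<delta>\<^sub>1: "0 < \<delta>\<^sub>1" "\<delta>\<^sub>1 \<le> 1" "\<delta>\<^sub>1 \<le> \<delta>\<^sub>0"
    using \<delta>\<^sub>0 by (auto simp: \<delta>\<^sub>1_def)
  have \<delta>: "0 < \<delta> n" "\<delta> n \<le> (1 / 2) ^ n" "\<delta> n \<le> \<delta>\<^sub>1" for n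
    using \<delta>\<^sub>1 by (auto simp: \<delta>_def mult_left_le_one_le mult_left_le power_le_one)
  have \<delta>_le: "\<delta> n \<le> 1" for n
    using \<delta>(3) \<delta>\<^sub>1(2) by (rule order_trans)
  define P where "P n I A r \<longleftrightarrow>
      (\<forall>i\<in>I. A i \<subseteq> X \<and> A i \<noteq> {} \<and> \<delta> n powr (1 / \<theta>) \<le> r i \<and> r i \<le> \<delta> n \<and>
         (\<forall>x\<in>A i. \<forall>y\<in>A i. d x y \<le> r i)) \<and>
      X \<subseteq> (\<Union>i\<in>I. A i) \<and> (\<forall>F. finite F \<and> F \<subseteq> I \<longrightarrow> (\<Sum>i\<in>F. r i powr s) \<le> 1)"
    for n and I :: "nat set" and A r
  have "\<forall>n. \<exists>I A r. P n I A r"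
    using cov \<delta>(1) order_trans[OF \<delta>(3) \<delta>\<^sub>1(3)] unfolding P_def by simp
  then obtain I A r where P: "\<And>n. P n (I n) (A n) (r n)"
    by metis
  have A: "A n i \<subseteq> X" "A n i \<noteq> {}" and r_ge: "\<delta> n powr (1 / \<theta>) \<le> r n i" and r_le: "r n i \<le> \<delta> n"
    and diam: "\<And>x y. x \<in> A n i \<Longrightarrow> y \<in> A n i \<Longrightarrow> d x y \<le> r n i" if "i \<in> I n" for n i
    using P[of n] that unfolding P_def by blast+
  have cover: "X \<subseteq> (\<Union>i\<in>I n. A n i)"
    and sums: "\<And>F. finite F \<Longrightarrow> F \<subseteq> I n \<Longrightarrow> (\<Sum>i\<in>F. r n i powr s) \<le> 1" for n
    using P[of n] unfolding P_def by blast+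
  have r_pos: "0 < r n i" if "i \<in> I n" for n i
    using r_ge[OF that] \<delta>(1)[of n] by (auto intro: less_le_trans[of 0 "\<delta> n powr (1 / \<theta>)"])
  \<comment> \<open>These divide the interval from \<open>s\<close> to 1 into three equal
    parts.\<close>
  define \<sigma> \<gamma> where "\<sigma> = (2 * s + 1) / 3" and "\<gamma> = (s + 2) / 3"
  have exponents: "s < \<sigma>" "\<sigma> < \<gamma>" "\<gamma> < 1" "0 < \<sigma>" "0 < \<gamma>"
    using s by (auto simp: \<sigma>_def \<gamma>_def)
  \<comment> \<open>Passing from exponent \<open>s\<close> to \<open>\<sigma>\<close> gains
    \<open>r n i powr (\<sigma> - s) \<le> w ^ n\<close> at scale \<open>n\<close>, hence
    summability over all scales.\<close>
  define w :: real where "w = (1 / 2) powr (\<sigma> - s)"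
  have w: "0 < w" "w < 1"
    using exponents powr_less_mono2[of "\<sigma> - s" "1/2" 1] by (auto simp: w_def)
  define g where "g n i = (if i \<in> I n then r n i powr \<sigma> else 0)" for n i
  have g_sums: "(\<Sum>i\<in>F. g n i) \<le> w ^ n" if "finite F" for n F
  proof -
    have "(\<Sum>i\<in>F. g n i) = (\<Sum>i\<in>F \<inter> I n. r n i powr \<sigma>)"
      using that by (simp add: g_def sum.inter_restrict)
    also have "\<dots> \<le> (\<Sum>i\<in>F \<inter> I n. w ^ n * r n i powr s)"
    proof (rule sum_mono)
      fix i assume "i \<in> F \<inter> I n"
      then have i: "i \<in> I n" by simp
      have "r n i powr (\<sigma> - s) \<le> ((1 / 2) ^ n) powr (\<sigma> - s)"
        using r_le[OF i] r_pos[OF i] \<delta>(2)[of n] exponents by (intro powr_mono2) auto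
      also have "\<dots> = w ^ n"
        by (simp add: w_def powr_power powr_realpow[symmetric] powr_powr mult.commute)
      finally have "r n i powr (\<sigma> - s) * r n i powr s \<le> w ^ n * r n i powr s"
        by (rule mult_right_mono) simp
      then show "r n i powr \<sigma> \<le> w ^ n * r n i powr s"
        by (simp add: powr_add[symmetric])
    qed
    also have "\<dots> \<le> w ^ n"
      using sums[of "F \<inter> I n" n] that w by (simp add: sum_distrib_left[symmetric] mult_left_le)
    finally show ?thesis .
  qed
  define m where "m j = (case prod_decode j of (n, i) \<Rightarrow> g n i)" for j
  define p where "p j = (case prod_decode j of (n, i) \<Rightarrow> if i \<in> I n then SOME x. x \<in> A n i else x0)" for j
  \<comment> \<open>Large enough for \<open>\<kappa> * t \<ge> \<sigma>\<close> below: the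
    \<open>t\<close>-th powers of the new diameters are then controlled by the masses.\<close>
  obtain K :: nat where K: "\<sigma> / t / (\<gamma> - \<sigma>) < real K"
    using reals_Archimedean2 by blast
  define \<kappa> where "\<kappa> = 1 + K * (\<gamma> - \<sigma>)"
  have \<kappa>: "0 < \<kappa>" "\<sigma> \<le> \<kappa> * t"
  proof -
    have "0 \<le> K * (\<gamma> - \<sigma>)" using exponents by simp
    then show "0 < \<kappa>" by (simp add: \<kappa>_def)
    have "\<sigma> \<le> K * (\<gamma> - \<sigma>) * t"
      using K exponents t by (simp add: divide_less_eq mult_ac)
    then show "\<sigma> \<le> \<kappa> * t"
      using t by (simp add: \<kappa>_def distrib_right)
  qed
  interpret metric_potential X d p m \<gamma> K
  proof (unfold metric_potential_def metric_potential_axioms_def, intro conjI allI X(1))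
    show "p j \<in> X" for j
    proof -
      obtain n i where j: "prod_decode j = (n, i)" by force
      have "(SOME x. x \<in> A n i) \<in> X" if "i \<in> I n"
        using A[OF that] some_in_eq[of "A n i"] by blast
      then show ?thesis
        using x0 by (simp add: p_def j)
    qed
    show "0 \<le> m j" for j
      by (simp add: m_def g_def split: prod.split)
    show "summable m"
      unfolding m_def using w g_sums by (intro summable_double_powers) (auto simp: g_def)
  qed (use exponents in auto)
  define \<rho> where "\<rho> n i = 2 ^ K * r n i powr \<kappa>" for n i
  have \<delta>_powr: "(\<delta> n) powr \<kappa> = \<delta>\<^sub>1 powr \<kappa> * ((1 / 2) powr \<kappa>) ^ n" for n
    by (simp add: \<delta>_def powr_mult powr_power powr_realpow[symmetric] powr_powr mult.commute)
  \<comment> \<open>The new scales are the \<open>\<kappa>\<close>-th powers of the old ones, hence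
    the ratio \<open>(1 / 2) powr \<kappa>\<close>. Raising
    \<open>\<delta> n powr (1 / \<theta>) \<le> r n i \<le> \<delta> n\<close> to the power
    \<open>\<kappa>\<close> again gives a window with exponent \<open>1 / \<theta>\<close>.\<close>
  have "upper_intermediate_dim X deformed \<theta> \<le> ereal t"
  proof (rule upper_intermediate_dim_le)
    show "Metric_space X deformed"
      by (rule Metric_space_deformed)
    show "Metric_space.mtotally_bounded X deformed X"
      using X(2) by (rule mtotally_bounded_deformed)
    show "0 < (1 / 2 :: real) powr \<kappa>" by simp
    show "(1 / 2 :: real) powr \<kappa> < 1"
      using \<kappa> powr_less_mono2[of \<kappa> "1/2" 1] by simp
    show "0 < 2 ^ K * (\<delta>\<^sub>1 powr \<kappa>) powr (1 / \<theta>)" "0 < 2 ^ K * \<delta>\<^sub>1 powr \<kappa>"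
      using \<delta>\<^sub>1 by simp_all
    show "2 ^ K * (\<delta>\<^sub>1 powr \<kappa>) powr (1 / \<theta>) * (((1 / 2) powr \<kappa>) ^ n) powr (1 / \<theta>) \<le> \<rho> n i"
      if "i \<in> I n" for n i
    proof -
      have "(\<delta>\<^sub>1 powr \<kappa>) powr (1 / \<theta>) * (((1 / 2) powr \<kappa>) ^ n) powr (1 / \<theta>) = (\<delta> n powr (1 / \<theta>)) powr \<kappa>"
        by (simp only: powr_mult[symmetric] \<delta>_powr[symmetric]) (simp add: powr_powr)
      also have "\<dots> \<le> r n i powr \<kappa>"
        using r_ge[OF that] \<kappa> by (intro powr_mono2) auto
      finally show ?thesis by (simp add: \<rho>_def)
    qed
    show "\<rho> n i \<le> 2 ^ K * \<delta>\<^sub>1 powr \<kappa> * ((1 / 2) powr \<kappa>) ^ n" if "i \<in> I n" for n i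
      using r_le[OF that] r_pos[OF that] \<kappa> powr_mono2[of \<kappa> "r n i" "\<delta> n"] by (simp add: \<rho>_def \<delta>_powr)
    show "deformed x y \<le> \<rho> n i" if i: "i \<in> I n" and xy: "x \<in> A n i" "y \<in> A n i" for n i x y
    proof -
      define j where "j = prod_encode (n, i)"
      have j: "m j = r n i powr \<sigma>" "p j \<in> A n i"
        using i A(2)[OF i] by (auto simp: j_def m_def p_def g_def some_in_eq)
      have "deformed x y \<le> (2 / (m j * r n i powr (-\<gamma>))) ^ K * r n i"
        using xy A(1)[OF i] diam[OF i] j r_pos[OF i] by (intro deformed_le_near_point) auto
      \<comment> \<open>With mass \<open>r n i powr \<sigma>\<close>, each of the \<open>K\<close>
        factors contributes \<open>r n i powr (\<gamma> - \<sigma>)\<close>; the remaining factor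
        \<open>r n i\<close> completes the exponent \<open>\<kappa>\<close>.\<close>
      also have "2 / (m j * r n i powr (-\<gamma>)) = 2 * r n i powr (\<gamma> - \<sigma>)"
        by (simp add: j powr_add[symmetric] powr_minus_divide[of "r n i" "\<sigma> - \<gamma>", simplified])
      also have "(2 * r n i powr (\<gamma> - \<sigma>)) ^ K * r n i = 2 ^ K * (r n i powr (K * (\<gamma> - \<sigma>)) * r n i powr 1)"
        using r_pos[OF i] by (simp add: power_mult_distrib powr_power mult.commute)
      also have "\<dots> = \<rho> n i"
        by (simp only: powr_add[symmetric] \<rho>_def \<kappa>_def add.commute)
      finally show ?thesis .
    qed
    show "A n i \<subseteq> X \<and> A n i \<noteq> {}" if "i \<in> I n" for n i
      using A that by blast
    show "X \<subseteq> (\<Union>i\<in>I n. A n i)" for n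
      by (rule cover)
    show "(\<Sum>i\<in>F. \<rho> n i powr t) \<le> (2 ^ K) powr t * w ^ n" if F: "finite F" "F \<subseteq> I n" for n F
    proof -
      have "(\<Sum>i\<in>F. \<rho> n i powr t) \<le> (\<Sum>i\<in>F. (2 ^ K) powr t * g n i)"
      proof (rule sum_mono)
        fix i assume "i \<in> F"
        then have i: "i \<in> I n" using F by blast
        have "r n i \<le> 1" using r_le[OF i] \<delta>_le by (rule order_trans)
        then have "r n i powr (\<kappa> * t) \<le> r n i powr \<sigma>"
          using r_pos[OF i] \<kappa> by (intro powr_mono') auto
        then show "\<rho> n i powr t \<le> (2 ^ K) powr t * g n i"
          using i by (simp add: \<rho>_def g_def powr_mult powr_powr)
      qed
      also have "\<dots> \<le> (2 ^ K) powr t * w ^ n"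
        using g_sums[OF F(1)] by (simp add: sum_distrib_left[symmetric])
      finally show ?thesis .
    qed
    show "(\<lambda>n. (2 ^ K) powr t * w ^ n) \<longlonglongrightarrow> 0"
      using w by (intro tendsto_mult_right_zero LIMSEQ_power_zero) simp
  qed (use \<theta> t in auto)
  then show ?thesis
    by (rule conformal_upper_intermediate_dim_le[OF Metric_space_deformed
          quasisymmetrically_equivalent_deformed])
qed

lemma upper_intermediate_dim_empty:
  assumes "Metric_space {} d" "0 < \<theta>" "\<theta> < 1"
  shows "upper_intermediate_dim {} d \<theta> = 0"
proof (rule antisym[OF _ upper_intermediate_dim_nonneg])
  have "upper_intermediate_dim {} d \<theta> \<le> ereal t" if "0 < t" for t
    by (rule upper_intermediate_dim_le[where q = "1/2" and b = 1 and C = 1 and I = "\<lambda>_. {}" and e = "\<lambda>_. 0"])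
      (use assms that Metric_space.mtotally_bounded_empty[OF assms(1)] in auto)
  then show "upper_intermediate_dim {} d \<theta> \<le> 0"
    by (rule_tac ereal_le_epsilon2) simp
qed

theorem theorem1p1:
  fixes X :: "'a set" and d :: "'a \<Rightarrow> 'a \<Rightarrow> real" and \<theta> :: real
  assumes "Metric_space X d"
    and "Metric_space.mtotally_bounded X d X"
    and "0 < \<theta>" and "\<theta> < 1"
    and "upper_intermediate_dim X d \<theta> < 1"
  shows "conformal_upper_intermediate_dim X d \<theta> = 0"
proof (rule antisym[OF _ conformal_upper_intermediate_dim_nonneg])
  show "conformal_upper_intermediate_dim X d \<theta> \<le> 0"
  \<comment> \<open>The construction needs a base point; the empty space is its own quasisymmetric
    model of dimension 0.\<close>
  proof (cases "X = {}")
    case True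
    then show ?thesis
      using assms quasisymmetrically_equivalent_empty
      by (intro conformal_upper_intermediate_dim_le[of X d]) (auto simp: upper_intermediate_dim_empty)
  next
    case False
    then show ?thesis
      using conformal_upper_intermediate_dim_le_pos[OF assms]
      by (rule_tac ereal_le_epsilon2) simp
  qed
qed

end
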